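(* Let $Y$ be a Bernoulli sum with variance $\sigma^2>0$ and let $\alpha\in[2,\infty]$. Then $$H_\alpha(Y)\ \geq\ \log\left[\frac{\sqrt{6\sigma^2\alpha'}}{\int_0^{\sqrt{6\sigma^2\alpha'}}e^{-t^2/2}\,dt}\right].$$ In particular, $$H_\alpha(Y)\ \geq\ \frac12\max\left\{\log\left(1+2\alpha'\sigma^2\right),\ \log\left(\frac{12\,\alpha'\sigma^2}{\pi}\right)\right\}.$$
   Context: A Bernoulli random variable $X$ takes values in $\{0,1\}$ with $\mathbb{P}(X=1)=p=1-\mathbb{P}(X=0)$ for some $p\in[0,1]$. A finite Bernoulli sum is a random variable with the distribution of $X_1+\cdots+X_n$ for some $n\in\mathbb{N}$ and independent (not necessarily identically distributed) Bernoulli random variables $X_i$. A Bernoulli sum is a random variable whose distribution is a limit, in the sense of convergence in distribution, of distributions of finite Bernoulli sums. For a $\mathbb{Z}$-valued random variable $X$ with $f_X(n)=\mathbb{P}(X=n)$, the $\alpha$-Rényi entropy is $H_\alpha(X)=(1-\alpha)^{-1}\log\sum_{n}f_X(n)^\alpha$ for $\alpha\in(1,\infty)$ and $H_\infty(X)=-\log\sup_n f_X(n)$, with $\log$ the natural logarithm. The conjugate exponent is $\alpha'=\alpha/(\alpha-1)$, with $\alpha'=1$ when $\alpha=\infty$. *)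

theory Defs
  imports "HOL-Probability.Probability"
begin

definition bernoulli_rv :: "'a measure \<Rightarrow> ('a \<Rightarrow> real) \<Rightarrow> bool" where
  "bernoulli_rv M X \<longleftrightarrow>
     X \<in> borel_measurable M \<and> (\<forall>\<omega>\<in>space M. X \<omega> \<in> {0, 1}) \<and>
     (\<exists>p\<in>{0..1}. measure M {\<omega> \<in> space M. X \<omega> = 1} = p \<and>
                measure M {\<omega> \<in> space M. X \<omega> = 0} = 1 - p)"

text \<open>The laws of finite Bernoulli sums. A definition cannot quantify over the type of the
  sample space, so the sample space ranges over the measures on one fixed type; this loses no
  law, by \<open>finite_bernoulli_law_distr\<close> below.\<close>

definition finite_bernoulli_law :: "real measure \<Rightarrow> bool" where
  "finite_bernoulli_law \<mu> \<longleftrightarrow>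
     (\<exists>(n::nat) (\<Omega> :: (nat \<Rightarrow> real) measure) (X :: nat \<Rightarrow> (nat \<Rightarrow> real) \<Rightarrow> real).
        prob_space \<Omega> \<and> (\<forall>i<n. bernoulli_rv \<Omega> (X i)) \<and>
        prob_space.indep_vars \<Omega> (\<lambda>_. borel) X {..<n} \<and>
        \<mu> = distr \<Omega> borel (\<lambda>\<omega>. \<Sum>i<n. X i \<omega>))"

lemma finite_bernoulli_law_distr:
  fixes M :: "'a measure" and X :: "nat \<Rightarrow> 'a \<Rightarrow> real"
  assumes M: "prob_space M" and bern: "\<And>i. i < n \<Longrightarrow> bernoulli_rv M (X i)"
    and ind: "prob_space.indep_vars M (\<lambda>_. borel) X {..<n}"
  shows "finite_bernoulli_law (distr M borel (\<lambda>\<omega>. \<Sum>i<n. X i \<omega>))"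
proof -
  interpret M: prob_space M by (fact M)
  define T where "T = (\<lambda>\<omega> (i::nat). if i < n then X i \<omega> else 0)"
  define N where "N = sigma (UNIV::(nat \<Rightarrow> real) set) {{f. f i \<in> B} |i B. B \<in> sets (borel::real measure)}"
  have spN: "space N = UNIV" by (simp add: N_def)
  have rv: "X i \<in> borel_measurable M" if "i < n" for i
    using bern[OF that] by (simp add: bernoulli_rv_def)
  have T: "T \<in> measurable M N"
    unfolding N_def
  proof (rule measurable_measure_of)
    fix y :: "(nat \<Rightarrow> real) set" assume "y \<in> {{f. f i \<in> B} |i B. B \<in> sets (borel::real measure)}"
    then obtain i B where y: "y = {f. f i \<in> B}" and B: "B \<in> sets borel" by blast
    have "(\<lambda>\<omega>. T \<omega> i) \<in> borel_measurable M"
      using rv by (cases "i < n") (auto simp: T_def)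
    from measurable_sets[OF this B] show "T -` y \<inter> space M \<in> sets M"
      by (simp add: y vimage_def)
  qed auto
  have coord: "(\<lambda>f. f i) \<in> borel_measurable N" for i
  proof (rule measurableI)
    fix B :: "real set" assume "B \<in> sets borel"
    then show "(\<lambda>f. f i) -` B \<inter> space N \<in> sets N"
      by (auto simp: N_def vimage_def)
  qed auto
  define \<Omega> where "\<Omega> = distr M N T"
  interpret \<Omega>: prob_space \<Omega>
    unfolding \<Omega>_def by (rule M.prob_space_distr[OF T])
  define Z where "Z = (\<lambda>i (f :: nat \<Rightarrow> real). if f i = 1 then 1 else (0::real))"
  have Zm: "Z i \<in> borel_measurable N" for i
    unfolding Z_def using coord[of i] by measurable
  have ZT: "Z i (T \<omega>) = X i \<omega>" if "i < n" "\<omega> \<in> space M" for i \<omega>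
    using bern[OF that(1)] that by (auto simp: Z_def T_def bernoulli_rv_def)
  have b: "bernoulli_rv \<Omega> (Z i)" if "i < n" for i
  proof -
    have "measure \<Omega> {f \<in> space \<Omega>. Z i f = c} = measure M {\<omega> \<in> space M. X i \<omega> = c}" for c
    proof -
      have "{f \<in> space N. Z i f = c} \<in> sets N"
        using Zm[of i] by measurable
      moreover have "T -` {f \<in> space N. Z i f = c} \<inter> space M = {\<omega> \<in> space M. X i \<omega> = c}"
        using ZT[OF that] by (auto simp: spN)
      ultimately show ?thesis
        by (simp add: \<Omega>_def measure_distr[OF T])
    qed
    then show ?thesis
      using bern[OF that] Zm[of i] by (auto simp: bernoulli_rv_def \<Omega>_def Z_def)
  qed
  have i: "\<Omega>.indep_vars (\<lambda>_. borel) Z {..<n}"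
  proof (cases "n = 0")
    case True
    then show ?thesis by (simp add: \<Omega>.indep_vars_def \<Omega>.indep_sets_def)
  next
    case False
    then have ne: "{..<n} \<noteq> {}" by auto
    have "distr \<Omega> (PiM {..<n} (\<lambda>_. borel)) (\<lambda>x. \<lambda>i\<in>{..<n}. Z i x)
        = distr M (PiM {..<n} (\<lambda>_. borel)) ((\<lambda>x. \<lambda>i\<in>{..<n}. Z i x) \<circ> T)"
      unfolding \<Omega>_def by (rule distr_distr) (use Zm T in \<open>auto intro!: measurable_restrict\<close>)
    also have "\<dots> = distr M (PiM {..<n} (\<lambda>_. borel)) (\<lambda>x. \<lambda>i\<in>{..<n}. X i x)"
      by (rule distr_cong) (auto simp: ZT fun_eq_iff restrict_def)
    also have "\<dots> = PiM {..<n} (\<lambda>i. distr M borel (X i))"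
      using M.indep_vars_iff_distr_eq_PiM'[OF ne, of X "\<lambda>_. borel"] rv ind by auto
    also have "\<dots> = PiM {..<n} (\<lambda>i. distr \<Omega> borel (Z i))"
    proof (rule PiM_cong)
      fix i assume "i \<in> {..<n}"
      then show "distr M borel (X i) = distr \<Omega> borel (Z i)"
        unfolding \<Omega>_def by (subst distr_distr[OF Zm T]) (auto intro!: distr_cong simp: ZT)
    qed simp
    finally show ?thesis
      using \<Omega>.indep_vars_iff_distr_eq_PiM'[OF ne, of Z "\<lambda>_. borel"] Zm by (auto simp: \<Omega>_def)
  qed
  have "distr M borel (\<lambda>\<omega>. \<Sum>i<n. X i \<omega>) = distr \<Omega> borel (\<lambda>f. \<Sum>i<n. Z i f)"
    unfolding \<Omega>_def
    by (subst distr_distr) (use Zm T in \<open>auto intro!: distr_cong sum.cong simp: ZT\<close>)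
  then show ?thesis
    unfolding finite_bernoulli_law_def
    using \<Omega>.prob_space_axioms b i by blast
qed

text \<open>The Renyi entropy is a notion for integer-valued random variables, so the variable is
  typed accordingly; convergence in distribution is that of the laws on the real line.\<close>

definition bernoulli_sum :: "'a measure \<Rightarrow> ('a \<Rightarrow> int) \<Rightarrow> bool" where
  "bernoulli_sum M Y \<longleftrightarrow>
     Y \<in> measurable M (count_space UNIV) \<and>
     (\<exists>\<mu>. (\<forall>k. finite_bernoulli_law (\<mu> k)) \<and>
          weak_conv_m \<mu> (distr M borel (\<lambda>\<omega>. real_of_int (Y \<omega>))))"

definition mass :: "'a measure \<Rightarrow> ('a \<Rightarrow> int) \<Rightarrow> int \<Rightarrow> real" where
  "mass M X n = measure M {\<omega> \<in> space M. X \<omega> = n}"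

text \<open>The order \<open>\<alpha>\<close> is meant to lie in \<open>(1, \<infinity>]\<close>; the values for other \<open>\<alpha>\<close> are irrelevant.\<close>

definition renyi_entropy :: "'a measure \<Rightarrow> ereal \<Rightarrow> ('a \<Rightarrow> int) \<Rightarrow> real" where
  "renyi_entropy M \<alpha> X =
     (if \<alpha> = \<infinity> then - ln (SUP n. mass M X n)
      else 1 / (1 - real_of_ereal \<alpha>) * ln (\<Sum>\<^sub>\<infinity>n. mass M X n powr real_of_ereal \<alpha>))"

definition conj_exponent :: "ereal \<Rightarrow> real" where
  "conj_exponent \<alpha> =
     (if \<alpha> = \<infinity> then 1 else real_of_ereal \<alpha> / (real_of_ereal \<alpha> - 1))"

end

(*  The Hausdorff--Young inequality bounds the l^alpha norm of the mass function of Y by the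
    L^alpha' norm of its characteristic function phi, so H_alpha(Y) is at least the negative
    logarithm of the mean of |phi|^alpha' over a period. A finite Bernoulli sum satisfies
    |phi(t)|^2 = prod (1 - 2 p_i (1 - p_i) (1 - cos t)) <= exp (-2 sigma^2 (1 - cos t)), which
    survives the weak limit. With c = alpha' sigma^2 it remains to bound the mean of
    exp (-c (1 - cos (pi x))) over [0, 1] by that of exp (-3 c x^2), a comparison in the convex
    order. Hausdorff--Young is obtained on Z/N, where the interpolating function is a finite
    exponential sum, and applied to the residues of Y modulo N as N tends to infinity. *)

theory Submission
  imports Defs "HOL-Complex_Analysis.Complex_Analysis" "HOL-Library.Real_Mod"
begin

text \<open>Hausdorff--Young needs an exponent \<alpha>' \<le> 2, whence \<alpha> \<ge> 2. Working
  on Z/N replaces function spaces by finite sums, at little cost: folding Y modulo N never decreases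
  a mass, and the majorant of |phi|^\<alpha>' is Lipschitz, so its mean over Z/N is a Riemann sum
  with error O(1/N).

  The delicate point is the weak limit. Variance is not continuous under convergence in
  distribution, yet the bound for phi must carry the variance of Y itself. The same product formula
  also bounds |phi|^2 from below in terms of the variance; if approximating variances stayed below
  some B < \<sigma>^2 infinitely often, this lower bound would pass to the limit and contradict the
  second-order expansion of phi at 0.

  The constant 6 is 2 * 3: the Gaussian exponent 3 c x^2 becomes t^2 / 2 under t = sqrt (6 c)
  x.\<close>

section \<open>Interpolation and the Hausdorff--Young inequality on Z/N\<close>

text \<open>Maximum modulus fails on an unbounded strip, so F is damped by exp (\<epsilon> (z^2 -
  1)). On the strip Re (z^2 - 1) \<le> - (Im z)^2, hence the damped function is small on the short
  sides of a tall rectangle. Letting \<epsilon> tend to 0 removes the factor and with it every trace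
  of C.\<close>

lemma three_lines:
  fixes F :: "complex \<Rightarrow> complex"
  assumes hol: "F holomorphic_on UNIV"
    and bdd: "\<And>z. 0 \<le> Re z \<Longrightarrow> Re z \<le> 1 \<Longrightarrow> norm (F z) \<le> C"
    and left: "\<And>z. Re z = 0 \<Longrightarrow> norm (F z) \<le> 1"
    and right: "\<And>z. Re z = 1 \<Longrightarrow> norm (F z) \<le> 1"
    and w: "0 \<le> Re w" "Re w \<le> 1"
  shows "norm (F w) \<le> 1"
proof -
  have eps: "norm (F w) * exp (\<epsilon> * Re (w\<^sup>2 - 1)) \<le> 1" if "\<epsilon> > 0" for \<epsilon> :: real
  proof -
    define G where "G z = F z * exp (of_real \<epsilon> * (z\<^sup>2 - 1))" for z
    have nG: "norm (G z) = norm (F z) * exp (\<epsilon> * ((Re z)\<^sup>2 - (Im z)\<^sup>2 - 1))" for z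
      by (simp add: G_def norm_mult Re_power2)
    have G_strip: "norm (G z) \<le> norm (F z) * exp (- (\<epsilon> * (Im z)\<^sup>2))" if "0 \<le> Re z" "Re z \<le> 1" for z
    proof -
      have "(Re z)\<^sup>2 \<le> 1" using that by (simp add: power_le_one)
      then have "\<epsilon> * ((Re z)\<^sup>2 - (Im z)\<^sup>2 - 1) \<le> \<epsilon> * (- (Im z)\<^sup>2)"
        using \<open>\<epsilon> > 0\<close> by (intro mult_left_mono) auto
      then show ?thesis unfolding nG by (intro mult_left_mono) auto
    qed
    have C0: "C \<ge> 0" using bdd[OF w] norm_ge_zero order_trans by blast
    \<comment> \<open>The first entry puts w inside the rectangle; the other two give C \<le>
      \<epsilon> R \<le> \<epsilon> R^2 \<le> exp (\<epsilon> R^2), so the damping beats C on the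
      short sides.\<close>
    define R where "R = max (\<bar>Im w\<bar>) (max 1 (C / \<epsilon>))"
    have R: "R \<ge> \<bar>Im w\<bar>" "R \<ge> 1" "R \<ge> C / \<epsilon>" by (auto simp: R_def)
    have "C \<le> \<epsilon> * R" using R \<open>\<epsilon> > 0\<close> by (simp add: field_simps)
    also have "\<dots> \<le> \<epsilon> * R\<^sup>2" using R \<open>\<epsilon> > 0\<close> by (simp add: power2_eq_square)
    also have "\<dots> \<le> exp (\<epsilon> * R\<^sup>2)" using exp_ge_add_one_self[of "\<epsilon> * R\<^sup>2"] by linarith
    finally have CR: "C * exp (- (\<epsilon> * R\<^sup>2)) \<le> 1" by (simp add: exp_minus field_simps)
    define S where "S = cbox (Complex 0 (-R)) (Complex 1 R)"
    have "norm (G w) \<le> 1"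
    proof (rule maximum_modulus_frontier[of G S])
      have "G holomorphic_on UNIV" unfolding G_def by (intro holomorphic_intros hol)
      then show "G holomorphic_on interior S" "continuous_on (closure S) G"
        using holomorphic_on_subset holomorphic_on_imp_continuous_on by blast+
      show "bounded S" by (simp add: S_def)
      show "w \<in> S" using R w by (auto simp: S_def in_cbox_complex_iff)
      fix z assume "z \<in> frontier S"
      then have z: "0 \<le> Re z" "Re z \<le> 1" "\<bar>Im z\<bar> \<le> R"
        "Re z = 0 \<or> Re z = 1 \<or> \<bar>Im z\<bar> = R"
        by (auto simp: S_def frontier_cbox in_cbox_complex_iff in_box_complex_iff)
      consider "norm (F z) \<le> 1" | "\<bar>Im z\<bar> = R" using z(4) left right by blast
      then show "norm (G z) \<le> 1"
      proof cases
        case 1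
        have "norm (F z) * exp (- (\<epsilon> * (Im z)\<^sup>2)) \<le> 1 * 1"
          using \<open>\<epsilon> > 0\<close> 1 by (intro mult_mono) auto
        then show ?thesis using G_strip[OF z(1,2)] by simp
      next
        case 2
        then have "(Im z)\<^sup>2 = R\<^sup>2" by (metis power2_abs)
        then have "norm (F z) * exp (- (\<epsilon> * (Im z)\<^sup>2)) \<le> C * exp (- (\<epsilon> * R\<^sup>2))"
          using bdd[OF z(1,2)] by simp
        then show ?thesis using CR G_strip[OF z(1,2)] by linarith
      qed
    qed
    then show ?thesis by (simp add: nG Re_power2)
  qed
  have "((\<lambda>\<epsilon>. norm (F w) * exp (\<epsilon> * Re (w\<^sup>2 - 1))) \<longlongrightarrow> norm (F w) * exp (0 * Re (w\<^sup>2 - 1))) (at_right 0)"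
    by (intro tendsto_intros)
  then show ?thesis
    using eps by (intro tendsto_upperbound[where F = "at_right (0::real)"])
      (auto simp: eventually_at_right_field intro!: exI[of _ 1])
qed

lemma sum_cis_orthogonal:
  fixes N j k :: nat
  assumes "j < N" "k < N"
  shows "(\<Sum>n<N. cis (2 * pi * real n * (real j - real k) / real N)) = (if j = k then of_nat N else 0)"
proof (cases "j = k")
  case False
  define w where "w = cis (2 * pi * (real j - real k) / real N)"
  have pw: "cis (2 * pi * real n * (real j - real k) / real N) = w ^ n" for n
  proof -
    have "2 * pi * real n * (real j - real k) / real N = real n * (2 * pi * (real j - real k) / real N)"
      by simp
    then show ?thesis by (simp only: w_def Complex.DeMoivre)
  qed
  have "w ^ N = cis (2 * pi * (of_int (int j - int k)))"
    using assms by (simp add: w_def Complex.DeMoivre)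
  also have "\<dots> = 1" by (rule cis_multiple_2pi) auto
  finally have wN: "w ^ N = 1" .
  have "w \<noteq> 1"
  proof
    assume "w = 1"
    then obtain m :: int where "2 * pi * (real j - real k) / real N = of_int m * (2 * pi)"
      by (auto simp: w_def cis_eq_1_iff)
    then have "(2 * pi) * ((real j - real k) / real N) = (2 * pi) * of_int m"
      by (simp only: times_divide_eq_right mult.commute)
    then have "(real j - real k) / real N = of_int m"
      by (rule mult_left_cancel[THEN iffD1, rotated]) simp
    then have "real j - real k = of_int m * real N"
      using assms by (simp add: field_simps)
    then have "real_of_int (int j - int k) = real_of_int (m * int N)" by simp
    then have "int j - int k = m * int N" by (simp only: of_int_eq_iff)
    then have "int N dvd int j - int k" by simp
    then have "int N \<le> \<bar>int j - int k\<bar>" using False by (intro zdvd_imp_le) (auto simp: dvd_abs_iff)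
    then show False using assms by linarith
  qed
  then show ?thesis using False wN by (simp add: pw geometric_sum)
qed auto

lemma norm_powr_nonneg_real: "r \<ge> 0 \<Longrightarrow> norm (complex_of_real r powr z) = r powr Re z"
  by (simp add: norm_powr_real_powr)

text \<open>Riesz--Thorin interpolation between the bounds \<open>\<ell>\<^sup>2 \<rightarrow> \<ell>\<^sup>2\<close> and \<open>\<ell>\<^sup>1 \<rightarrow> \<ell>\<^sup>\<infinity>\<close>; the exponent
  \<open>p (1 + z) / 2\<close> runs from \<open>p / 2\<close> to \<open>p\<close> across the strip and equals \<open>1\<close> at \<open>z = 2 / p - 1\<close>.\<close>

lemma riesz_thorin_normalised:
  fixes e :: "nat \<Rightarrow> nat \<Rightarrow> complex" and A :: "nat \<Rightarrow> complex" and b :: "nat \<Rightarrow> real"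
  assumes N: "N > 0" and p: "1 \<le> p" "p \<le> 2"
    and e1: "\<And>j n. norm (e j n) \<le> 1"
    and e2: "\<And>X. (\<Sum>n<N. (norm (\<Sum>j<N. X j * e j n))\<^sup>2) \<le> N * (\<Sum>j<N. (norm (X j))\<^sup>2)"
    and b0: "\<And>n. b n \<ge> 0"
    and A1: "(\<Sum>j<N. norm (A j) powr p) = N" and b1: "(\<Sum>n<N. b n powr p) = 1"
  shows "norm (\<Sum>n<N. b n * (\<Sum>j<N. A j * e j n)) \<le> N"
proof -
  \<comment> \<open>The factor \<open>sgn (A j)\<close> carries the phase, so that only a
    nonnegative real is raised to a complex power. Zero entries stay zero for every z.\<close>
  define X where "X z j = sgn (A j) * of_real (norm (A j)) powr (of_real p * (1 + z) / 2)" for z :: complex and j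
  define B where "B z n = of_real (b n) powr (of_real p * (1 + z) / 2)" for z :: complex and n
  define F where "F z = (\<Sum>n<N. B z n * (\<Sum>j<N. X z j * e j n)) / N" for z
  have nX: "norm (X z j) = norm (A j) powr (p * (1 + Re z) / 2)" for z j
    by (auto simp: X_def norm_mult norm_sgn norm_powr_nonneg_real)
  have nB: "norm (B z n) = b n powr (p * (1 + Re z) / 2)" for z n
    using b0 by (simp add: B_def norm_powr_nonneg_real)
  define w where "w = complex_of_real (2 / p - 1)"
  have ex: "of_real p * (1 + w) / 2 = 1" using p by (simp add: w_def)
  have Xw: "X w j = A j" for j
  proof (cases "A j = 0")
    case False
    then show ?thesis unfolding X_def ex by (simp add: powr_one sgn_div_norm scaleR_conv_of_real)
  qed (simp add: X_def)
  have Bw: "B w n = b n" for n unfolding B_def ex by (cases "b n = 0") auto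
  have l1: "norm (F z) \<le> (\<Sum>n<N. norm (B z n)) * (\<Sum>j<N. norm (X z j)) / N" for z
  proof -
    have "norm (B z n * (\<Sum>j<N. X z j * e j n)) \<le> norm (B z n) * (\<Sum>j<N. norm (X z j))" for n
    proof -
      have "norm (\<Sum>j<N. X z j * e j n) \<le> (\<Sum>j<N. norm (X z j))"
        using e1 by (intro sum_norm_le) (auto simp: norm_mult mult_left_le)
      then show ?thesis by (simp add: norm_mult mult_left_mono)
    qed
    then have "norm (\<Sum>n<N. B z n * (\<Sum>j<N. X z j * e j n)) \<le> (\<Sum>n<N. norm (B z n) * (\<Sum>j<N. norm (X z j)))"
      by (intro sum_norm_le) auto
    then show ?thesis by (simp add: F_def norm_divide divide_right_mono sum_distrib_right)
  qed
  \<comment> \<open>Only finiteness of C matters. Replacing each base by its maximum with 1 makes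
    the power monotone in the exponent, which is at most p on the strip.\<close>
  define C where "C = (\<Sum>n<N. (max 1 (b n)) powr p) * (\<Sum>j<N. (max 1 (norm (A j))) powr p) / N"
  have "norm (F w) \<le> 1"
  proof (rule three_lines[where F = F and C = C])
    show "F holomorphic_on UNIV"
      unfolding F_def X_def B_def using N by (intro holomorphic_intros) auto
    show "norm (F z) \<le> C"
      if z: "0 \<le> Re z" "Re z \<le> 1" for z
    proof -
      have le: "x powr (p * (1 + Re z) / 2) \<le> max 1 x powr p" if "x \<ge> 0" for x
      proof -
        have "x powr (p * (1 + Re z) / 2) \<le> max 1 x powr (p * (1 + Re z) / 2)"
          using that z p by (intro powr_mono2) auto
        also have "\<dots> \<le> max 1 x powr p"
          using z p by (intro powr_mono) (auto simp: field_simps)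
        finally show ?thesis .
      qed
      show ?thesis unfolding C_def
        by (rule order_trans[OF l1])
          (use le b0 in \<open>auto simp: nX nB intro!: divide_right_mono mult_mono sum_mono sum_nonneg\<close>)
    qed
    \<comment> \<open>On this edge the exponent is p, and the trivial bound gives 1 * N / N.\<close>
    show "norm (F z) \<le> 1" if "Re z = 1" for z
      using l1[of z] A1 b1 N that by (simp add: nX nB)
    \<comment> \<open>On this edge the exponent is p / 2, so squares of moduli are p-th powers:
      Cauchy--Schwarz and \<open>e2\<close> give (1 * N * N)^(1/2) / N = 1.\<close>
    show "norm (F z) \<le> 1" if z: "Re z = 0" for z
    proof -
      have sq: "(x powr (p / 2))\<^sup>2 = x powr p" for x :: real
        by (cases "x = 0") (auto simp: power2_eq_square powr_add[symmetric])
      have "norm (\<Sum>n<N. B z n * (\<Sum>j<N. X z j * e j n)) \<le> (\<Sum>n<N. norm (B z n) * norm (\<Sum>j<N. X z j * e j n))"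
        by (intro sum_norm_le) (simp add: norm_mult)
      then have "(norm (\<Sum>n<N. B z n * (\<Sum>j<N. X z j * e j n)))\<^sup>2
          \<le> (\<Sum>n<N. norm (B z n) * norm (\<Sum>j<N. X z j * e j n))\<^sup>2"
        by (intro power_mono) auto
      also have "\<dots> \<le> (\<Sum>n<N. (norm (B z n))\<^sup>2) * (\<Sum>n<N. (norm (\<Sum>j<N. X z j * e j n))\<^sup>2)"
        by (rule Cauchy_Schwarz_ineq_sum)
      also have "(\<Sum>n<N. (norm (B z n))\<^sup>2) = 1" using b1 z by (simp add: nB sq)
      also have "1 * (\<Sum>n<N. (norm (\<Sum>j<N. X z j * e j n))\<^sup>2) \<le> N * (\<Sum>j<N. (norm (X z j))\<^sup>2)"
        using e2[of "X z"] by simp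
      also have "(\<Sum>j<N. (norm (X z j))\<^sup>2) = N" using A1 z by (simp add: nX sq)
      also have "real N * real N = (real N)\<^sup>2" by (simp add: power2_eq_square)
      finally have "norm (\<Sum>n<N. B z n * (\<Sum>j<N. X z j * e j n)) \<le> N"
        by (rule power2_le_imp_le) simp
      then show ?thesis using N by (simp add: F_def norm_divide)
    qed
    show "0 \<le> Re w" "Re w \<le> 1" using p by (auto simp: w_def field_simps)
  qed
  then show ?thesis using N by (simp add: F_def Xw Bw norm_divide)
qed

text \<open>Both sides are homogeneous of degree 1 in A and in b, so dividing by u and v reaches the
  normalised case; vanishing u or v forces both sides to be 0. Frequencies j carry the uniform
  probability measure and positions n the counting measure, which is why N divides only one of the
  sums.\<close>

lemma riesz_thorin:
  fixes e :: "nat \<Rightarrow> nat \<Rightarrow> complex" and A :: "nat \<Rightarrow> complex" and b :: "nat \<Rightarrow> real"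
  assumes N: "N > 0" and p: "1 \<le> p" "p \<le> 2"
    and e1: "\<And>j n. norm (e j n) \<le> 1"
    and e2: "\<And>X. (\<Sum>n<N. (norm (\<Sum>j<N. X j * e j n))\<^sup>2) \<le> N * (\<Sum>j<N. (norm (X j))\<^sup>2)"
    and b0: "\<And>n. b n \<ge> 0"
  shows "norm (\<Sum>n<N. b n * (\<Sum>j<N. A j * e j n))
    \<le> N * ((\<Sum>j<N. norm (A j) powr p) / N) powr (1/p) * (\<Sum>n<N. b n powr p) powr (1/p)"
proof -
  define u where "u = ((\<Sum>j<N. norm (A j) powr p) / N) powr (1/p)"
  define v where "v = (\<Sum>n<N. b n powr p) powr (1/p)"
  have up: "u powr p = (\<Sum>j<N. norm (A j) powr p) / N" and vp: "v powr p = (\<Sum>n<N. b n powr p)"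
    using p by (auto simp: u_def v_def powr_powr sum_nonneg)
  have uv0: "u \<ge> 0" "v \<ge> 0" by (auto simp: u_def v_def)
  show ?thesis
  proof (cases "u = 0 \<or> v = 0")
    case True
    then have "(\<Sum>j<N. norm (A j) powr p) = 0 \<or> (\<Sum>n<N. b n powr p) = 0"
      using up vp N by auto
    then have "(\<forall>j<N. A j = 0) \<or> (\<forall>n<N. b n = 0)"
      by (auto simp: sum_nonneg_eq_0_iff)
    then have "(\<Sum>n<N. b n * (\<Sum>j<N. A j * e j n)) = 0" by auto
    then show ?thesis by simp
  next
    case False
    then have uv: "u > 0" "v > 0" using uv0 by auto
    have "norm (\<Sum>n<N. of_real (b n / v) * (\<Sum>j<N. (A j / u) * e j n)) \<le> N"
    proof (rule riesz_thorin_normalised[OF N p e1 e2])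
      show "(\<Sum>j<N. norm (A j / complex_of_real u) powr p) = N"
      proof -
        have "(\<Sum>j<N. norm (A j / complex_of_real u) powr p) = (\<Sum>j<N. norm (A j) powr p / u powr p)"
          using uv by (intro sum.cong) (auto simp: norm_divide powr_divide)
        also have "\<dots> = (N * u powr p) / u powr p"
          unfolding sum_divide_distrib[symmetric] up using N by simp
        also have "\<dots> = N" using uv by simp
        finally show ?thesis .
      qed
      show "(\<Sum>n<N. (b n / v) powr p) = 1"
      proof -
        have "(\<Sum>n<N. (b n / v) powr p) = (\<Sum>n<N. b n powr p / v powr p)"
          using uv b0 by (intro sum.cong) (auto simp: powr_divide)
        also have "\<dots> = v powr p / v powr p"
          unfolding sum_divide_distrib[symmetric] vp ..
        also have "\<dots> = 1" using uv by simp
        finally show ?thesis .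
      qed
    qed (use b0 uv in auto)
    also have "(\<Sum>n<N. of_real (b n / v) * (\<Sum>j<N. (A j / u) * e j n)) = (\<Sum>n<N. b n * (\<Sum>j<N. A j * e j n)) / (u * v)"
      by (simp add: sum_distrib_left sum_divide_distrib mult_ac)
    finally show ?thesis using uv by (simp add: norm_divide norm_mult u_def[symmetric] v_def[symmetric] field_simps)
  qed
qed

text \<open>Parseval on Z/N: expanding the square leaves only the diagonal terms, by orthogonality
  of characters. This is the hypothesis \<open>e2\<close> of the interpolation.\<close>

lemma fourier_l2_bound:
  "(\<Sum>n<N. (norm (\<Sum>j<N. X j * cis (- (2 * pi * real j * real n / real N))))\<^sup>2)
    \<le> N * (\<Sum>j<N. (norm (X j))\<^sup>2)"
proof -
  define e where "e j n = cis (- (2 * pi * real j * real n / real N))" for j n :: nat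
  have ee: "e j n * cnj (e k n) = cis (2 * pi * real n * (real k - real j) / real N)" for j k n
    unfolding e_def cis_cnj cis_mult by (rule arg_cong[where f = cis]) (simp add: algebra_simps diff_divide_distrib)
  have "complex_of_real (\<Sum>n<N. (norm (\<Sum>j<N. X j * e j n))\<^sup>2)
      = (\<Sum>n<N. (\<Sum>j<N. X j * e j n) * cnj (\<Sum>k<N. X k * e k n))"
    by (simp only: of_real_sum complex_norm_square)
  also have "\<dots> = (\<Sum>n<N. \<Sum>j<N. \<Sum>k<N. X j * cnj (X k) * (e j n * cnj (e k n)))"
    by (simp only: cnj_sum sum_product complex_cnj_mult mult_ac)
  also have "\<dots> = (\<Sum>j<N. \<Sum>n<N. \<Sum>k<N. X j * cnj (X k) * (e j n * cnj (e k n)))"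
    by (rule sum.swap)
  also have "\<dots> = (\<Sum>j<N. \<Sum>k<N. \<Sum>n<N. X j * cnj (X k) * (e j n * cnj (e k n)))"
    by (intro sum.cong refl sum.swap)
  also have "\<dots> = (\<Sum>j<N. \<Sum>k<N. X j * cnj (X k) * (if k = j then of_nat N else 0))"
    unfolding sum_distrib_left[symmetric] ee
    by (intro sum.cong refl arg_cong2[where f = "(*)"] sum_cis_orthogonal) auto
  also have "\<dots> = (\<Sum>j<N. of_nat N * (X j * cnj (X j)))"
    by (intro sum.cong refl) (simp add: if_distrib sum.delta mult_ac cong: if_cong)
  also have "\<dots> = complex_of_real (N * (\<Sum>j<N. (norm (X j))\<^sup>2))"
    by (simp only: of_real_mult of_real_sum complex_norm_square sum_distrib_left of_real_of_nat_eq)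
  finally have "(\<Sum>n<N. (norm (\<Sum>j<N. X j * e j n))\<^sup>2) = N * (\<Sum>j<N. (norm (X j))\<^sup>2)"
    by (simp only: of_real_eq_iff)
  then show ?thesis by (simp add: e_def)
qed

lemma fourier_inversion:
  assumes "n < N"
  shows "(\<Sum>j<N. (\<Sum>r<N. a r * cis (2 * pi * real j * real r / real N)) * cis (- (2 * pi * real j * real n / real N)))
     = of_nat N * a n"
proof -
  have "cis (2 * pi * real j * real r / real N) * cis (- (2 * pi * real j * real n / real N))
     = cis (2 * pi * real j * (real r - real n) / real N)" for j r :: nat
    unfolding cis_mult by (rule arg_cong[where f = cis]) (simp add: algebra_simps diff_divide_distrib)
  then have "(\<Sum>j<N. (\<Sum>r<N. a r * cis (2 * pi * real j * real r / real N)) * cis (- (2 * pi * real j * real n / real N)))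
    = (\<Sum>j<N. \<Sum>r<N. a r * cis (2 * pi * real j * (real r - real n) / real N))"
    by (simp only: sum_distrib_right mult.assoc)
  also have "\<dots> = (\<Sum>r<N. a r * (\<Sum>j<N. cis (2 * pi * real j * (real r - real n) / real N)))"
    unfolding sum_distrib_left by (rule sum.swap)
  also have "\<dots> = (\<Sum>r<N. a r * (if r = n then of_nat N else 0))"
    using assms by (intro sum.cong refl arg_cong2[where f = "(*)"] sum_cis_orthogonal) auto
  also have "\<dots> = of_nat N * a n"
    using assms by (simp add: if_distrib sum.delta mult_ac cong: if_cong)
  finally show ?thesis .
qed

text \<open>Fourier inversion writes N * a n as a transform of the transform of a, which then plays
  the role of A in the interpolated bilinear bound. The bilinear form leaves b free: a point mass
  with p = 1 bounds a single value, a power of a bounds an l^q norm.\<close>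

lemma hausdorff_young_dual:
  fixes a b :: "nat \<Rightarrow> real"
  assumes N: "N > 0" and p: "1 \<le> p" "p \<le> 2" and b: "\<And>n. b n \<ge> 0"
  shows "(\<Sum>n<N. a n * b n)
    \<le> ((\<Sum>j<N. norm (\<Sum>r<N. a r * cis (2 * pi * real j * real r / real N)) powr p) / N) powr (1/p)
      * (\<Sum>n<N. b n powr p) powr (1/p)" (is "_ \<le> ?R")
proof -
  have "real N * (\<Sum>n<N. a n * b n) = Re (\<Sum>n<N. b n * (of_nat N * complex_of_real (a n)))"
    by (simp add: sum_distrib_left mult_ac)
  also have "\<dots> \<le> norm (\<Sum>n<N. b n * (of_nat N * complex_of_real (a n)))"
    by (rule complex_Re_le_cmod)
  also have "(\<Sum>n<N. b n * (of_nat N * complex_of_real (a n)))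
    = (\<Sum>n<N. b n * (\<Sum>j<N. (\<Sum>r<N. a r * cis (2 * pi * real j * real r / real N))
         * cis (- (2 * pi * real j * real n / real N))))"
    by (intro sum.cong refl) (simp only: lessThan_iff fourier_inversion)
  also have "norm \<dots> \<le> N * ?R"
    unfolding mult.assoc[symmetric]
    using riesz_thorin[OF N p _ fourier_l2_bound b, where A = "\<lambda>j. \<Sum>r<N. a r * cis (2 * pi * real j * real r / real N)"]
    by (simp add: mult_ac)
  finally show ?thesis using N by simp
qed

text \<open>The test vector a^(q-1) is the equality case of Hoelder. Since (q - 1) p = q, the dual
  inequality reads s \<le> P^(1/p) s^(1/p) with the same sum s on both sides; dividing leaves
  s^(1/q) \<le> P^(1/p), and the q-th power has exponent q / p = q - 1.\<close>

lemma hausdorff_young: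
  fixes a :: "nat \<Rightarrow> real"
  assumes N: "N > 0" and q: "2 \<le> q" and a: "\<And>n. a n \<ge> 0"
  shows "(\<Sum>n<N. a n powr q)
    \<le> ((\<Sum>j<N. norm (\<Sum>r<N. a r * cis (2 * pi * real j * real r / real N)) powr (q / (q - 1))) / N) powr (q - 1)"
    (is "?s \<le> ?P powr _")
proof -
  define p where "p = q / (q - 1)"
  have p: "1 \<le> p" "p \<le> 2" and pq: "(q - 1) * p = q" "1 / p = (q - 1) / q" "p > 0" using q by (auto simp: p_def field_simps)
  have "(\<Sum>n<N. a n * a n powr (q - 1)) \<le> ?P powr (1/p) * (\<Sum>n<N. (a n powr (q - 1)) powr p) powr (1/p)"
    using hausdorff_young_dual[OF N p, of "\<lambda>n. a n powr (q - 1)" a] by (simp add: p_def)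
  also have "(\<Sum>n<N. a n * a n powr (q - 1)) = ?s"
    using a q by (intro sum.cong refl) (simp add: powr_mult_base)
  also have "(\<Sum>n<N. (a n powr (q - 1)) powr p) = ?s"
    by (simp only: powr_powr pq)
  finally have le: "?s \<le> ?P powr (1/p) * ?s powr (1/p)" .
  have s0: "?s \<ge> 0" and P0: "?P \<ge> 0" by (auto intro!: sum_nonneg divide_nonneg_nonneg)
  show ?thesis
  proof (cases "?s = 0")
    case False
    then have s: "?s > 0" using s0 by simp
    have "1 / q = 1 - 1 / p" using q unfolding pq by (simp add: diff_divide_distrib)
    then have "?s powr (1 / q) = ?s powr 1 / ?s powr (1 / p)" by (simp only: powr_diff)
    also have "?s powr 1 = ?s" using s by simp
    also have "?s / ?s powr (1 / p) \<le> ?P powr (1 / p)"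
      using s le by (simp add: divide_le_eq)
    finally have "(?s powr (1 / q)) powr q \<le> (?P powr (1 / p)) powr q"
      using q by (intro powr_mono2) auto
    then show ?thesis using s q by (simp add: powr_powr pq)
  qed (simp only: powr_ge_zero)
qed

section \<open>Means over a period and their comparison with a Gaussian\<close>

lemma riemann_sum_le_integral:
  fixes h :: "real \<Rightarrow> real"
  assumes lip: "\<And>x y. \<bar>h x - h y\<bar> \<le> K * \<bar>x - y\<bar>" and N: "N > 0"
  shows "(\<Sum>j<N. h (real j / real N)) / N \<le> integral {0..1} h + K / N"
proof -
  have "K-lipschitz_on UNIV h"
    using lip lip[of 0 1] by (intro lipschitz_onI) (auto simp: dist_real_def)
  then have cont: "continuous_on S h" for S
    using lipschitz_on_continuous_on continuous_on_subset by blast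
  have K0: "K \<ge> 0" using lip[of 0 1] by simp
  \<comment> \<open>On each cell of length 1/N the function drops by at most K/N below its left
    value, which costs K/N^2 per cell.\<close>
  have "(\<Sum>j<m. h (real j / real N)) / N \<le> integral {0..real m / real N} h + real m * (K / N\<^sup>2)" for m
  proof (induction m)
    case (Suc m)
    let ?a = "real m / real N" and ?b = "real (Suc m) / real N"
    have ab: "0 \<le> ?a" "?a \<le> ?b" and w: "?b - ?a = 1 / N"
      using N by (auto simp: divide_right_mono diff_divide_distrib[symmetric])
    have "h ?a / N - K / N\<^sup>2 = integral {?a..?b} (\<lambda>x. h ?a - K / N)"
    proof -
      have "integral {?a..?b} (\<lambda>x. h ?a - K / N) = (?b - ?a) * (h ?a - K / N)" using ab by simp
      then show ?thesis unfolding w by (simp add: power2_eq_square right_diff_distrib)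
    qed
    also have "\<dots> \<le> integral {?a..?b} h"
    proof (rule integral_le)
      fix x assume x: "x \<in> {?a..?b}"
      then have "\<bar>?a - x\<bar> \<le> 1 / N" using w by auto
      then have "K * \<bar>?a - x\<bar> \<le> K * (1 / N)" using K0 by (intro mult_left_mono) auto
      then show "h ?a - K / N \<le> h x" using lip[of ?a x] by simp
    qed (auto intro!: integrable_continuous_interval cont)
    finally have "h ?a / N \<le> integral {?a..?b} h + K / N\<^sup>2" by simp
    moreover have "integral {0..?a} h + integral {?a..?b} h = integral {0..?b} h"
      using ab by (intro Henstock_Kurzweil_Integration.integral_combine integrable_continuous_interval cont) auto
    ultimately show ?case using Suc.IH
      by (simp add: add_divide_distrib distrib_right)
  qed simp
  from this[of N] show ?thesis using N by (simp add: power2_eq_square)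
qed

text \<open>The substitutions x = 2 t and x = 2 - 2 t fold the two halves of the period onto [0, 1].
  After this the cosine is monotone on the domain of integration, as the comparison below
  requires.\<close>

lemma integral_cos_period:
  fixes k :: "real \<Rightarrow> real"
  assumes k: "continuous_on UNIV k"
  shows "integral {0..1} (\<lambda>t. k (cos (2 * pi * t))) = integral {0..1} (\<lambda>x. k (cos (pi * x)))"
proof -
  define I where "I = integral {0..1} (\<lambda>x. k (cos (pi * x)))"
  have "((\<lambda>x. k (cos (pi * x))) has_integral I) (cbox 0 1)"
    unfolding I_def cbox_interval
    by (intro integrable_integral integrable_continuous_interval continuous_on_compose2[OF k] continuous_intros) auto
  note aff = has_integral_affinity[OF this, of 2 0] has_integral_affinity[OF this, of "-2" 2]
  have im1: "(\<lambda>x::real. (1 / 2) *\<^sub>R x + - ((1 / 2) *\<^sub>R 0)) ` cbox 0 1 = {0..1/2}"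
    by (simp add: image_affinity_atLeastAtMost)
  have im2: "(\<lambda>x::real. (1 / - 2) *\<^sub>R x + - ((1 / - 2) *\<^sub>R 2)) ` cbox 0 1 = {1/2..1}"
  proof (intro equalityI subsetI)
    fix x :: real assume "x \<in> {1/2..1}"
    then have "x = (1 / - 2) *\<^sub>R (2 - 2 * x) + - ((1 / - 2) *\<^sub>R 2)" "2 - 2 * x \<in> cbox 0 1"
      by (auto simp: field_simps)
    then show "x \<in> (\<lambda>x::real. (1 / - 2) *\<^sub>R x + - ((1 / - 2) *\<^sub>R 2)) ` cbox 0 1" by blast
  qed auto
  have "((\<lambda>t. k (cos (2 * pi * t))) has_integral I / 2) {0..1/2}"
    using aff(1) unfolding im1 by (simp add: mult_ac)
  moreover have "((\<lambda>t. k (cos (2 * pi * t))) has_integral I / 2) {1/2..1}"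
  proof -
    have "cos (pi * (-2 * t + 2)) = cos (2 * pi * t)" for t
    proof -
      have "cos (pi * (-2 * t + 2)) = cos (2 * pi - 2 * pi * t)" by (simp add: algebra_simps)
      then show ?thesis by (simp add: cos_diff)
    qed
    then show ?thesis using aff(2) unfolding im2 by simp
  qed
  ultimately have "((\<lambda>t. k (cos (2 * pi * t))) has_integral I / 2 + I / 2) {0..1}"
    by (intro has_integral_combine[of 0 "1/2" 1]) auto
  then show ?thesis unfolding I_def[symmetric] by (simp add: integral_unique)
qed

lemma sin_star_shaped:
  assumes "0 \<le> t" "t \<le> 1" "0 \<le> u" "u \<le> pi"
  shows "t * sin u \<le> sin (t * u)"
proof -
  have "convex_on {0..pi} (\<lambda>x. - sin x)"
  proof (rule f''_ge0_imp_convex[where f' = "\<lambda>x. - cos x" and f'' = sin])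
    fix x :: real assume "x \<in> {0..pi}"
    then show "sin x \<ge> 0" by (simp add: sin_ge_zero)
  qed (auto intro!: derivative_eq_intros)
  from convex_onD[OF this, of t 0 u] assms show ?thesis by simp
qed

text \<open>Both \<open>3 x\<^sup>2\<close> and \<open>1 - cos (\<pi> x)\<close> have mean \<open>1\<close> over \<open>[0, 1]\<close>, and their difference changes
  sign exactly once, from minus to plus; so the former dominates the latter in the convex order.\<close>

lemma integral_exp_cos_le:
  fixes c :: real
  assumes c: "c \<ge> 0"
  shows "integral {0..1} (\<lambda>x. exp (- (c * (1 - cos (pi * x))))) \<le> integral {0..1} (\<lambda>x. exp (- (3 * c * x\<^sup>2)))"
proof -
  define D where "D x = 3 * x\<^sup>2 - (1 - cos (pi * x))" for x :: real
  define w where "w x = exp (- (c * (1 - cos (pi * x))))" for x :: real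
  have cos_sin: "1 - cos (pi * x) = 2 * (sin (pi * x / 2))\<^sup>2" for x
    using cos_double_sin[of "pi * x / 2"] by simp
  \<comment> \<open>This says that D x / x^2 is nondecreasing, because sin u / u is nonincreasing;
    hence D cannot return to negative values after its zero.\<close>
  have scale: "D x \<le> (x / y)\<^sup>2 * D y" if "0 \<le> x" "x \<le> y" "0 < y" "y \<le> 1" for x y
  proof -
    have "x / y * sin (pi * y / 2) \<le> sin (x / y * (pi * y / 2))"
      using that by (intro sin_star_shaped) auto
    also have "x / y * (pi * y / 2) = pi * x / 2" using that by simp
    finally have "(x / y * sin (pi * y / 2))\<^sup>2 \<le> (sin (pi * x / 2))\<^sup>2"
      using that by (intro power_mono mult_nonneg_nonneg sin_ge_zero) (auto intro: order_trans[of _ "pi * 1"])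
    then have "(x / y)\<^sup>2 * (2 * (sin (pi * y / 2))\<^sup>2) \<le> 2 * (sin (pi * x / 2))\<^sup>2"
      unfolding power_mult_distrib by simp
    moreover have "(x / y)\<^sup>2 * (3 * y\<^sup>2) = 3 * x\<^sup>2" using that by (simp add: power_divide)
    ultimately show ?thesis unfolding D_def cos_sin by (simp only: right_diff_distrib)
  qed
  have contD: "continuous_on S D" for S unfolding D_def by (intro continuous_intros)
  have "D (1/2) \<le> 0" "D 1 \<ge> 0" by (simp_all add: D_def power2_eq_square)
  then obtain x0 where x0: "1/2 \<le> x0" "x0 \<le> 1" "D x0 = 0"
    using IVT'[of D "1/2" 0 1, OF _ _ _ contD] by auto
  have neg: "D x \<le> 0" if "0 \<le> x" "x \<le> x0" for x
    using scale[of x x0] that x0 by simp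
  have pos: "D y \<ge> 0" if "x0 \<le> y" "y \<le> 1" for y
    using scale[of x0 y] that x0 by (auto simp: zero_le_mult_iff)
  \<comment> \<open>The weight w is nonincreasing while D passes from minus to plus at x0, so (w x -
    w x0) * D x \<le> 0 on both sides of x0.\<close>
  have wD: "w x * D x \<le> w x0 * D x" if x: "x \<in> {0..1}" for x
  proof (cases "x \<le> x0")
    case True
    then have "cos (pi * x) \<ge> cos (pi * x0)" using x x0 by (intro cos_monotone_0_pi_le) auto
    then have "w x \<ge> w x0" using c by (simp add: w_def mult_left_mono)
    then show ?thesis using neg True x by (intro mult_right_mono_neg) auto
  next
    case False
    then have "cos (pi * x) \<le> cos (pi * x0)" using x x0 by (intro cos_monotone_0_pi_le) auto
    then have "w x \<le> w x0" using c by (simp add: w_def mult_left_mono)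
    then show ?thesis using pos False x by (intro mult_right_mono) auto
  qed
  \<comment> \<open>The antiderivative is x^3 - x + sin (pi x) / pi, which vanishes at both
    ends.\<close>
  have "(D has_integral (1 ^ 3 - 1 + sin (pi * 1) / pi) - (0 ^ 3 - 0 + sin (pi * 0) / pi)) {0..1}"
    by (rule fundamental_theorem_of_calculus)
      (auto simp: D_def has_real_derivative_iff_has_vector_derivative[symmetric] intro!: derivative_eq_intros)
  then have "(D has_integral 0) {0..1}" by simp
  then have D0: "((\<lambda>x. - (c * w x0) * D x) has_integral - (c * w x0) * 0) {0..1}"
    by (rule has_integral_mult_right)
  \<comment> \<open>The right side equals w x * exp (- c D x), which lies above its tangent w x * (1
    - c D x); \<open>wD\<close> then replaces w x by the constant w x0, so that the correction
    integrates to 0.\<close>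
  have "w x + - (c * w x0) * D x \<le> exp (- (3 * c * x\<^sup>2))" if x: "x \<in> {0..1}" for x
  proof -
    have "w x - c * (w x0 * D x) \<le> w x - c * (w x * D x)"
      using mult_left_mono[OF wD[OF x] c] by simp
    also have "\<dots> = w x * (1 + - (c * D x))" by (simp add: algebra_simps)
    also have "\<dots> \<le> w x * exp (- (c * D x))"
      by (intro mult_left_mono exp_ge_add_one_self) (auto simp: w_def)
    also have "\<dots> = exp (- (3 * c * x\<^sup>2))"
      by (simp add: w_def D_def exp_add[symmetric] algebra_simps)
    finally show ?thesis by (simp add: mult.assoc)
  qed
  moreover have "((\<lambda>x. w x + - (c * w x0) * D x) has_integral (integral {0..1} w + - (c * w x0) * 0)) {0..1}"
    by (intro has_integral_add D0 integrable_integral integrable_continuous_interval)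
      (auto simp: w_def intro!: continuous_intros)
  ultimately have "integral {0..1} w + - (c * w x0) * 0 \<le> integral {0..1} (\<lambda>x. exp (- (3 * c * x\<^sup>2)))"
    by (intro has_integral_le[OF _ integrable_integral] integrable_continuous_interval continuous_intros) auto
  then show ?thesis by (simp add: w_def[abs_def])
qed

section \<open>Bounds for the Gaussian integral\<close>

lemma gaussian_integral_rescale:
  fixes s :: real
  assumes "s > 0"
  shows "integral {0..s} (\<lambda>t. exp (- t\<^sup>2 / 2)) = s * integral {0..1} (\<lambda>x. exp (- (s\<^sup>2 / 2 * x\<^sup>2)))"
proof -
  have "((\<lambda>t. exp (- t\<^sup>2 / 2)) has_integral integral {0..s} (\<lambda>t. exp (- t\<^sup>2 / 2))) {0..s}"
    by (intro integrable_integral integrable_continuous_interval continuous_intros) auto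
  from has_integral_stretch_real[OF this, of s] assms
  have "((\<lambda>x. exp (- (s * x)\<^sup>2 / 2)) has_integral (1 / s * integral {0..s} (\<lambda>t. exp (- t\<^sup>2 / 2)))) {0..1}"
    by (simp add: image_divide_atLeastAtMost)
  then show ?thesis using assms by (simp add: power_mult_distrib integral_unique)
qed

text \<open>The power 3/2 of 1 + t^2/3 \<le> exp (t^2/3) bounds the integrand by (1 + t^2/3)^(-3/2),
  which has the elementary antiderivative t / sqrt (1 + t^2/3). For s^2 = 6 c the denominator
  becomes sqrt (1 + 2 c).\<close>

lemma gaussian_integral_le_algebraic:
  fixes s :: real
  assumes "s \<ge> 0"
  shows "integral {0..s} (\<lambda>t. exp (- t\<^sup>2 / 2)) \<le> s / sqrt (1 + s\<^sup>2 / 3)"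
proof -
  define u where "u t = 1 + t\<^sup>2 / 3" for t :: real
  have u: "u t > 0" for t by (auto simp: u_def intro: add_pos_nonneg)
  have deriv: "((\<lambda>t. t / sqrt (u t)) has_real_derivative 1 / (u t * sqrt (u t))) (at t within T)" for t T
  proof -
    have "((\<lambda>t. t / sqrt (u t)) has_real_derivative (sqrt (u t) - t * (t / 3 / sqrt (u t))) / (sqrt (u t) * sqrt (u t))) (at t within T)"
      unfolding u_def using u[of t]
      by (auto simp: u_def field_simps intro!: derivative_eq_intros)
    moreover have "(sqrt (u t) - t * (t / 3 / sqrt (u t))) = 1 / sqrt (u t)"
    proof -
      have "sqrt (u t) * sqrt (u t) = 1 + t\<^sup>2 / 3" using u[of t] by (simp add: u_def)
      then have "sqrt (u t) = (1 + t\<^sup>2 / 3) / sqrt (u t)" using u[of t] by (simp add: eq_divide_eq)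
      then show ?thesis by (simp add: add_divide_distrib power2_eq_square)
    qed
    ultimately show ?thesis using u[of t] by (simp add: mult_ac)
  qed
  have "((\<lambda>t. 1 / (u t * sqrt (u t))) has_integral s / sqrt (u s) - 0 / sqrt (u 0)) {0..s}"
    using assms deriv
    by (intro fundamental_theorem_of_calculus) (auto simp: has_real_derivative_iff_has_vector_derivative[symmetric])
  moreover have "exp (- t\<^sup>2 / 2) \<le> 1 / (u t * sqrt (u t))" for t
  proof -
    have ue: "u t \<le> exp (t\<^sup>2 / 3)" unfolding u_def by (rule exp_ge_add_one_self)
    have "sqrt (u t) \<le> sqrt ((exp (t\<^sup>2 / 6))\<^sup>2)"
      using ue by (subst exp_double[symmetric]) (simp add: mult_ac)
    then have "u t * sqrt (u t) \<le> exp (t\<^sup>2 / 3) * exp (t\<^sup>2 / 6)"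
      using ue u[of t] by (intro mult_mono) auto
    also have "\<dots> = exp (t\<^sup>2 / 2)" by (simp add: exp_add[symmetric])
    finally show ?thesis using u[of t] by (simp add: exp_minus field_simps)
  qed
  ultimately have "integral {0..s} (\<lambda>t. exp (- t\<^sup>2 / 2)) \<le> s / sqrt (u s) - 0 / sqrt (u 0)"
    by (intro has_integral_le[OF integrable_integral] integrable_continuous_interval continuous_intros) auto
  then show ?thesis by (simp add: u_def)
qed

text \<open>The right side is the integral over the whole half-line, obtained from that of exp (-
  x^2) by t = sqrt 2 * x.\<close>

lemma gaussian_integral_le_sqrt:
  fixes s :: real
  assumes "s > 0"
  shows "integral {0..s} (\<lambda>t. exp (- t\<^sup>2 / 2)) \<le> sqrt (pi / 2)"
proof -
  have "((\<lambda>x. indicator {0..} x *\<^sub>R exp (- x\<^sup>2)) has_integral (sqrt pi / 2)) (UNIV :: real set)"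
    using has_integral_integral_lborel gaussian_moment_0 unfolding has_bochner_integral_iff by metis
  moreover have "(\<lambda>x. indicator {0..} x *\<^sub>R exp (- x\<^sup>2)) = (\<lambda>x::real. if x \<in> {0..} then exp (- x\<^sup>2) else 0)"
    by auto
  ultimately have half: "((\<lambda>x::real. exp (- x\<^sup>2)) has_integral (sqrt pi / 2)) {0..}"
    by (simp only: has_integral_restrict_UNIV)
  have "((\<lambda>t. exp (- t\<^sup>2 / 2)) has_integral integral {0..s} (\<lambda>t. exp (- t\<^sup>2 / 2))) {0..s}"
    by (intro integrable_integral integrable_continuous_interval continuous_intros) auto
  from has_integral_stretch_real[OF this, of "sqrt 2"] assms
  have "((\<lambda>x. exp (- x\<^sup>2)) has_integral (1 / sqrt 2 * integral {0..s} (\<lambda>t. exp (- t\<^sup>2 / 2)))) {0..s / sqrt 2}"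
    by (simp add: image_divide_atLeastAtMost power_mult_distrib)
  then have "1 / sqrt 2 * integral {0..s} (\<lambda>t. exp (- t\<^sup>2 / 2)) \<le> sqrt pi / 2"
    by (rule has_integral_subset_le[OF _ _ half, rotated]) auto
  then have "integral {0..s} (\<lambda>t. exp (- t\<^sup>2 / 2)) \<le> sqrt pi * sqrt 2 / 2"
    by (simp add: field_simps)
  also have "sqrt pi * sqrt 2 / 2 = sqrt (pi / 2)"
    by (simp add: real_sqrt_divide field_simps)
  finally show ?thesis .
qed

section \<open>Characteristic functions of Bernoulli sums\<close>

lemma (in prob_space) char_bernoulli:
  assumes "bernoulli_rv M X"
  obtains p :: real where "0 \<le> p" "p \<le> 1" "\<And>t. char (distr M borel X) t = 1 + p * (iexp t - 1)"
proof -
  have X [measurable]: "X \<in> borel_measurable M" and X01: "\<And>\<omega>. \<omega> \<in> space M \<Longrightarrow> X \<omega> \<in> {0, 1}"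
    using assms unfolding bernoulli_rv_def by blast+
  define p where "p = prob {\<omega> \<in> space M. X \<omega> = 1}"
  have p: "0 \<le> p" "p \<le> 1" "prob {\<omega> \<in> space M. X \<omega> = 1} = p"
    by (auto simp: p_def)
  define E where "E = {\<omega> \<in> space M. X \<omega> = 1}"
  have E: "E \<in> events" unfolding E_def by measurable
  have "char (distr M borel X) t = 1 + p * (iexp t - 1)" for t
  proof -
    have "char (distr M borel X) t = (CLINT \<omega>|M. iexp (t * X \<omega>))"
      by (simp add: char_def integral_distr)
    also have "\<dots> = (CLINT \<omega>|M. 1 + indicator E \<omega> *\<^sub>R (iexp t - 1))"
      by (intro Bochner_Integration.integral_cong) (auto simp: E_def indicator_def dest!: X01)
    also have "\<dots> = 1 + p * (iexp t - 1)"
    proof -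
      have "has_bochner_integral M (\<lambda>\<omega>. indicator E \<omega> *\<^sub>R (iexp t - 1)) (p *\<^sub>R (iexp t - 1))"
        using has_bochner_integral_indicator[OF E] p by (simp add: E_def[symmetric] less_top[symmetric])
      then show ?thesis
        by (simp add: has_bochner_integral_iff prob_space scaleR_conv_of_real del: integral_scaleR_left)
    qed
    finally show ?thesis .
  qed
  then show thesis by (rule that[OF p(1,2)])
qed

text \<open>The modulus depends on p only through the variance p (1 - p), so products of such
  factors can be bounded by the total variance alone.\<close>

lemma norm_bernoulli_char:
  fixes p t :: real
  shows "(norm (1 + p * (iexp t - 1)))\<^sup>2 = 1 - 2 * (p * (1 - p)) * (1 - cos t)"
proof -
  have "(norm (1 + p * (iexp t - 1)))\<^sup>2 = (1 + p * (cos t - 1))\<^sup>2 + (p * sin t)\<^sup>2"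
    by (simp add: cmod_power2 Re_exp Im_exp)
  also have "\<dots> = 1 + 2 * p * (cos t - 1) + p\<^sup>2 * ((sin t)\<^sup>2 + (cos t)\<^sup>2 + 1 - 2 * cos t)"
    by algebra
  also have "\<dots> = 1 - 2 * (p * (1 - p)) * (1 - cos t)"
    unfolding sin_cos_squared_add by (simp add: power2_eq_square algebra_simps)
  finally show ?thesis .
qed

text \<open>Weierstrass' product inequality; it turns the product formula for |phi|^2 into a lower
  bound by the variance.\<close>

lemma one_minus_sum_le_prod:
  fixes x :: "nat \<Rightarrow> real"
  assumes "\<And>i. i < n \<Longrightarrow> 0 \<le> x i" "\<And>i. i < n \<Longrightarrow> x i \<le> 1"
  shows "1 - (\<Sum>i<n. x i) \<le> (\<Prod>i<n. 1 - x i)"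
  using assms
proof (induction n)
  case (Suc n)
  have "(\<Prod>i<n. 1 - x i) \<le> (\<Prod>i<n. 1)" using Suc.prems by (intro prod_mono) (auto simp: less_SucI)
  then have "(\<Prod>i<n. 1 - x i) * x n \<le> 1 * x n" using Suc.prems by (intro mult_right_mono) auto
  moreover have "1 - (\<Sum>i<n. x i) \<le> (\<Prod>i<n. 1 - x i)" using Suc by simp
  ultimately show ?case by (simp add: right_diff_distrib)
qed simp

text \<open>Here \<open>v\<close> is the variance of \<open>\<mu>\<close>.\<close>

lemma finite_bernoulli_law_char_bounds:
  assumes "finite_bernoulli_law \<mu>"
  obtains v where "real_distribution \<mu>" "0 \<le> v"
    "\<And>t. (norm (char \<mu> t))\<^sup>2 \<le> exp (- (2 * v * (1 - cos t)))"
    "\<And>t. 1 - 2 * v * (1 - cos t) \<le> (norm (char \<mu> t))\<^sup>2"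
proof -
  from assms obtain n and \<Omega> :: "(nat \<Rightarrow> real) measure" and X :: "nat \<Rightarrow> (nat \<Rightarrow> real) \<Rightarrow> real" where \<Omega>: "prob_space \<Omega>"
    and bern: "\<And>i. i < n \<Longrightarrow> bernoulli_rv \<Omega> (X i)"
    and ind: "prob_space.indep_vars \<Omega> (\<lambda>_. borel) X {..<n}"
    and \<mu>: "\<mu> = distr \<Omega> borel (\<lambda>\<omega>. \<Sum>i<n. X i \<omega>)"
    unfolding finite_bernoulli_law_def by blast
  interpret prob_space \<Omega> by fact
  have "\<exists>p. i < n \<longrightarrow> 0 \<le> p \<and> p \<le> 1 \<and> (\<forall>t. char (distr \<Omega> borel (X i)) t = 1 + complex_of_real p * (iexp t - 1))" for i
  proof (cases "i < n")
    case True
    show ?thesis by (rule char_bernoulli[OF bern[OF True]]) blast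
  qed simp
  then obtain p where "\<forall>i. i < n \<longrightarrow> 0 \<le> p i \<and> p i \<le> 1
      \<and> (\<forall>t. char (distr \<Omega> borel (X i)) t = 1 + complex_of_real (p i) * (iexp t - 1))"
    by (rule choice[OF allI, THEN exE])
  then have p: "\<And>i. i < n \<Longrightarrow> 0 \<le> p i" "\<And>i. i < n \<Longrightarrow> p i \<le> 1"
    "\<And>i t. i < n \<Longrightarrow> char (distr \<Omega> borel (X i)) t = 1 + complex_of_real (p i) * (iexp t - 1)"
    by blast+
  \<comment> \<open>Twice the variance of the i-th summand.\<close>
  define q where "q i = 2 * (p i * (1 - p i))" for i
  have char: "(norm (char \<mu> t))\<^sup>2 = (\<Prod>i<n. 1 - q i * (1 - cos t))" for t
    unfolding \<mu> char_distr_sum[OF ind] prod_norm[symmetric] prod_power_distrib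
    by (intro prod.cong refl) (simp add: p norm_bernoulli_char q_def)
  \<comment> \<open>Since p (1 - p) \<le> 1/4 and 1 - cos t \<le> 2, every factor of the product
    lies in [0, 1]; both product estimates rely on this.\<close>
  have q: "0 \<le> q i * (1 - cos t)" "q i * (1 - cos t) \<le> 1" if "i < n" for i t
  proof -
    have "0 \<le> p i * (1 - p i)" using p that by simp
    moreover have "p i * (1 - p i) \<le> 1 / 4"
      using zero_le_power2[of "p i - 1 / 2"] by (simp add: power2_eq_square algebra_simps)
    ultimately have b: "0 \<le> q i" "q i \<le> 1 / 2" by (auto simp: q_def)
    moreover have c: "0 \<le> 1 - cos t" "1 - cos t \<le> 2" using cos_ge_minus_one[of t] by auto
    ultimately show "0 \<le> q i * (1 - cos t)" by simp
    from mult_mono[OF b(2) c(2)] b c show "q i * (1 - cos t) \<le> 1" by simp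
  qed
  define v where "v = (\<Sum>i<n. q i) / 2"
  have v: "2 * v * (1 - cos t) = (\<Sum>i<n. q i * (1 - cos t))" for t
    by (simp add: v_def sum_distrib_right)
  show thesis
  proof
    \<comment> \<open>At t = pi / 2 the factor 1 - cos t is 1, which isolates q i.\<close>
    show "0 \<le> v" using q(1)[of _ "pi / 2"] by (auto simp: v_def intro!: sum_nonneg)
    have "\<And>i. i < n \<Longrightarrow> X i \<in> borel_measurable \<Omega>" using bern by (auto simp: bernoulli_rv_def)
    then show "real_distribution \<mu>" unfolding \<mu> by (intro real_distribution_distr) auto
    show "(norm (char \<mu> t))\<^sup>2 \<le> exp (- (2 * v * (1 - cos t)))" for t
    proof -
      have "(\<Prod>i<n. 1 - q i * (1 - cos t)) \<le> (\<Prod>i<n. exp (- (q i * (1 - cos t))))"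
      proof (intro prod_mono conjI)
        fix i assume "i \<in> {..<n}"
        then show "0 \<le> 1 - q i * (1 - cos t)" using q by simp
        show "1 - q i * (1 - cos t) \<le> exp (- (q i * (1 - cos t)))"
          using exp_ge_add_one_self[of "- (q i * (1 - cos t))"] by simp
      qed
      then show ?thesis by (simp add: char v exp_sum[symmetric] sum_negf)
    qed
    show "1 - 2 * v * (1 - cos t) \<le> (norm (char \<mu> t))\<^sup>2" for t
      unfolding char v using q by (intro one_minus_sum_le_prod) auto
  qed
qed

lemma one_minus_cos_le: "1 - cos t \<le> t\<^sup>2 / 2" for t :: real
proof -
  have "1 - cos t = 2 * (sin (t / 2))\<^sup>2" using cos_double_sin[of "t / 2"] by simp
  also have "(sin (t / 2))\<^sup>2 \<le> (t / 2)\<^sup>2"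
    using abs_sin_x_le_abs_x[of "t / 2"] by (simp only: abs_le_square_iff)
  finally show ?thesis by (simp add: power_divide)
qed

text \<open>With s the variance, |phi t|^2 \<le> 1 - s t^2 + o(t^2) as t tends to 0. Comparison with
  1 - B t^2 along a null sequence gives s \<le> B. Centring X multiplies phi by a unimodular factor
  only.\<close>

lemma (in prob_space) variance_le_of_char_bound:
  assumes X [measurable]: "X \<in> borel_measurable M"
    and pos: "variance X > 0"
    and char: "\<And>t. 1 - B * t\<^sup>2 \<le> (norm (char (distr M borel X) t))\<^sup>2"
  shows "variance X \<le> B"
proof -
  define s where "s = variance X"
  define Z where "Z \<omega> = X \<omega> - expectation X" for \<omega>
  have Zm [measurable]: "Z \<in> borel_measurable M" unfolding Z_def by measurable
  \<comment> \<open>The integral of a non-integrable function is 0 by convention, so a positive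
    variance certifies a finite second moment.\<close>
  have Z2: "integrable M (\<lambda>\<omega>. (Z \<omega>)\<^sup>2)"
    using pos not_integrable_integral_eq unfolding Z_def by fastforce
  have Z1: "integrable M Z" by (rule square_integrable_imp_integrable[OF Zm Z2])
  then have "integrable M (\<lambda>\<omega>. Z \<omega> + expectation X)" by simp
  then have "integrable M X" by (simp add: Z_def)
  then have EZ: "expectation Z = 0" unfolding Z_def by (simp add: prob_space)
  then have VZ: "variance Z = s" by (simp add: s_def Z_def[abs_def])
  have nchar: "norm (char (distr M borel Z) t) = norm (char (distr M borel X) t)" for t
  proof -
    have "char (distr M borel Z) t = (CLINT \<omega>|M. iexp (t * X \<omega>) * iexp (- t * expectation X))"
      by (simp add: char_def integral_distr Z_def exp_add[symmetric] algebra_simps)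
    also have "\<dots> = char (distr M borel X) t * iexp (- t * expectation X)"
      by (simp add: char_def integral_distr)
    finally show ?thesis by (simp add: norm_mult)
  qed
  define u where "u n = inverse (real (Suc n))" for n
  have u0: "u \<longlonglongrightarrow> 0" unfolding u_def by (rule LIMSEQ_inverse_real_of_nat)
  have upos: "u n > 0" for n by (simp add: u_def)
  \<comment> \<open>The Taylor remainder of \<open>char_approx3'\<close> divided by u^2. The minimum
    with 6 Z^2 allows dominated convergence from a second moment alone, with no third
    moment.\<close>
  define \<eta> where "\<eta> n = expectation (\<lambda>x. min (6 * (Z x)\<^sup>2) (\<bar>u n\<bar> * \<bar>Z x\<bar> ^ 3)) / 6" for n
  have "(\<lambda>n. expectation (\<lambda>x. min (6 * (Z x)\<^sup>2) (\<bar>u n\<bar> * \<bar>Z x\<bar> ^ 3))) \<longlonglongrightarrow> expectation (\<lambda>x. 0)"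
  proof (rule integral_dominated_convergence[where w = "\<lambda>x. 6 * (Z x)\<^sup>2"])
    show "AE x in M. (\<lambda>n. min (6 * (Z x)\<^sup>2) (\<bar>u n\<bar> * \<bar>Z x\<bar> ^ 3)) \<longlonglongrightarrow> 0"
    proof (rule AE_I2)
      fix x
      have "(\<lambda>n. min (6 * (Z x)\<^sup>2) (\<bar>u n\<bar> * \<bar>Z x\<bar> ^ 3)) \<longlonglongrightarrow> min (6 * (Z x)\<^sup>2) (\<bar>0\<bar> * \<bar>Z x\<bar> ^ 3)"
        by (intro tendsto_intros u0)
      then show "(\<lambda>n. min (6 * (Z x)\<^sup>2) (\<bar>u n\<bar> * \<bar>Z x\<bar> ^ 3)) \<longlonglongrightarrow> 0" by simp
    qed
  qed (use Z2 in auto)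
  then have \<eta>0: "\<eta> \<longlonglongrightarrow> 0" unfolding \<eta>_def by (intro tendsto_divide_zero) simp
  define \<kappa> where "\<kappa> n = s / 2 - \<eta> n" for n
  have "(\<lambda>n. 2 * \<kappa> n - (u n)\<^sup>2 * (\<kappa> n)\<^sup>2) \<longlonglongrightarrow> 2 * (s / 2 - 0) - 0\<^sup>2 * (s / 2 - 0)\<^sup>2"
    unfolding \<kappa>_def by (intro tendsto_intros \<eta>0 u0)
  moreover have "\<forall>\<^sub>F n in sequentially. 2 * \<kappa> n - (u n)\<^sup>2 * (\<kappa> n)\<^sup>2 \<le> B"
  \<comment> \<open>Once u^2 s < 2, the main term 1 - u^2 s / 2 is positive and equals its
    modulus.\<close>
  proof -
    have "(\<lambda>n. (u n)\<^sup>2 * s) \<longlonglongrightarrow> 0\<^sup>2 * s" by (intro tendsto_intros u0)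
    then have "\<forall>\<^sub>F n in sequentially. (u n)\<^sup>2 * s < 2"
      by (rule order_tendstoD) simp
    then show ?thesis
    proof eventually_elim
      case (elim n)
      let ?c = "char (distr M borel Z) (u n)"
      have "cmod (?c - (1 - (u n)\<^sup>2 * s / 2)) \<le> (u n)\<^sup>2 / 6 * (6 * \<eta> n)"
        using char_approx3'[OF Zm Z1 Z2 EZ VZ refl, of "u n"] by (simp add: \<eta>_def)
      then have "cmod ?c \<le> cmod (1 - (u n)\<^sup>2 * s / 2) + (u n)\<^sup>2 * \<eta> n"
        using norm_triangle_sub[of ?c "1 - (u n)\<^sup>2 * s / 2"] by simp
      also have "cmod (1 - (u n)\<^sup>2 * s / 2) = 1 - (u n)\<^sup>2 * s / 2"
      proof -
        have "cmod (complex_of_real (1 - (u n)\<^sup>2 * s / 2)) = \<bar>1 - (u n)\<^sup>2 * s / 2\<bar>"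
          by (rule norm_of_real)
        then show ?thesis using elim by simp
      qed
      also have "1 - (u n)\<^sup>2 * s / 2 + (u n)\<^sup>2 * \<eta> n = 1 - (u n)\<^sup>2 * \<kappa> n"
        by (simp add: \<kappa>_def algebra_simps)
      finally have "(cmod ?c)\<^sup>2 \<le> (1 - (u n)\<^sup>2 * \<kappa> n)\<^sup>2" by (intro power_mono) auto
      then have "1 - B * (u n)\<^sup>2 \<le> (1 - (u n)\<^sup>2 * \<kappa> n)\<^sup>2"
        using char[of "u n"] nchar[of "u n"] by simp
      then have "(u n)\<^sup>2 * (2 * \<kappa> n - (u n)\<^sup>2 * (\<kappa> n)\<^sup>2) \<le> (u n)\<^sup>2 * B"
        by (simp add: power2_eq_square algebra_simps)
      then show ?case using upos[of n] by simp
    qed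
  qed
  ultimately have "2 * (s / 2 - 0) - 0\<^sup>2 * (s / 2 - 0)\<^sup>2 \<le> B"
    by (intro tendsto_upperbound) auto
  then show ?thesis by (simp add: s_def)
qed

text \<open>The variances of the approximating laws need not converge to that of the limit, but their
  lower limit dominates it.\<close>

lemma (in prob_space) bernoulli_sum_char_bound:
  assumes Y: "bernoulli_sum M Y"
    and var: "variance (\<lambda>\<omega>. real_of_int (Y \<omega>)) = \<sigma>\<^sup>2" and pos: "\<sigma>\<^sup>2 > 0"
  shows "norm (char (distr M borel (\<lambda>\<omega>. real_of_int (Y \<omega>))) t) \<le> exp (- (\<sigma>\<^sup>2 * (1 - cos t)))"
proof -
  define \<nu> where "\<nu> = distr M borel (\<lambda>\<omega>. real_of_int (Y \<omega>))"
  from Y obtain \<mu> where [measurable]: "Y \<in> measurable M (count_space UNIV)"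
    and \<mu>: "\<And>k. finite_bernoulli_law (\<mu> k)" and conv: "weak_conv_m \<mu> \<nu>"
    by (auto simp: bernoulli_sum_def \<nu>_def)
  have \<nu>: "real_distribution \<nu>" unfolding \<nu>_def by (intro real_distribution_distr) measurable
  have "\<exists>v. real_distribution (\<mu> k) \<and> 0 \<le> v \<and> (\<forall>t. (norm (char (\<mu> k) t))\<^sup>2 \<le> exp (- (2 * v * (1 - cos t))))
     \<and> (\<forall>t. 1 - 2 * v * (1 - cos t) \<le> (norm (char (\<mu> k) t))\<^sup>2)" for k
    using finite_bernoulli_law_char_bounds[OF \<mu>[of k]] by metis
  then obtain v where v: "\<And>k. real_distribution (\<mu> k)" "\<And>k. 0 \<le> v k"
    "\<And>k t. (norm (char (\<mu> k) t))\<^sup>2 \<le> exp (- (2 * v k * (1 - cos t)))"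
    "\<And>k t. 1 - 2 * v k * (1 - cos t) \<le> (norm (char (\<mu> k) t))\<^sup>2"
    by metis
  have lim: "(\<lambda>k. (norm (char (\<mu> k) t))\<^sup>2) \<longlonglongrightarrow> (norm (char \<nu> t))\<^sup>2" for t
    by (intro tendsto_intros levy_continuity1 v(1) \<nu> conv)
  \<comment> \<open>A strict inequality B < \<sigma>^2 leaves room for the contradiction; B tends to
    \<sigma>^2 from the left at the end.\<close>
  have below: "(norm (char \<nu> t))\<^sup>2 \<le> exp (- (2 * B * (1 - cos t)))" if B: "B < \<sigma>\<^sup>2" for B
  proof -
    \<comment> \<open>If v k < B infinitely often, then 1 - B t^2 is below |char (\<mu> k) t|^2 for
      those k, hence below the limit for every t, and the expansion at 0 would give \<sigma>^2 \<le>
      B.\<close>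
    have "\<forall>\<^sub>F k in sequentially. B \<le> v k"
    proof (rule ccontr)
      assume "\<not> ?thesis"
      then have freq: "\<exists>\<^sub>F k in sequentially. v k < B"
        by (simp add: frequently_def not_less)
      have "1 - B * t\<^sup>2 \<le> (norm (char \<nu> t))\<^sup>2" for t
      proof (rule ccontr)
        assume "\<not> ?thesis"
        then have "\<forall>\<^sub>F k in sequentially. (norm (char (\<mu> k) t))\<^sup>2 < 1 - B * t\<^sup>2"
          by (intro order_tendstoD(2)[OF lim]) simp
        then have "\<exists>\<^sub>F k in sequentially. (norm (char (\<mu> k) t))\<^sup>2 < 1 - B * t\<^sup>2 \<and> v k < B"
          by (rule frequently_eventually_conj[OF freq])
        then obtain k where k: "v k < B" "(norm (char (\<mu> k) t))\<^sup>2 < 1 - B * t\<^sup>2"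
          by (auto dest: frequently_ex)
        have "2 * v k * (1 - cos t) \<le> B * t\<^sup>2"
        proof -
          have "2 * v k * (1 - cos t) \<le> 2 * B * (t\<^sup>2 / 2)"
            using k(1) v(2)[of k] by (intro mult_mono one_minus_cos_le) auto
          then show ?thesis by simp
        qed
        then show False using v(4)[of k t] k(2) by linarith
      qed
      then have "\<sigma>\<^sup>2 \<le> B"
        using variance_le_of_char_bound[of "\<lambda>\<omega>. real_of_int (Y \<omega>)" B] var pos by (simp add: \<nu>_def)
      then show False using B by simp
    qed
    then have "\<forall>\<^sub>F k in sequentially. (norm (char (\<mu> k) t))\<^sup>2 \<le> exp (- (2 * B * (1 - cos t)))"
    proof eventually_elim
      case (elim k)
      have "2 * B * (1 - cos t) \<le> 2 * v k * (1 - cos t)" using elim by (intro mult_right_mono) auto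
      then show ?case using v(3)[of k t] by (meson exp_le_cancel_iff neg_le_iff_le order_trans)
    qed
    then show ?thesis by (intro tendsto_upperbound[OF lim]) auto
  qed
  have "(norm (char \<nu> t))\<^sup>2 \<le> exp (- (2 * \<sigma>\<^sup>2 * (1 - cos t)))"
  proof (rule tendsto_lowerbound)
    show "((\<lambda>B. exp (- (2 * B * (1 - cos t)))) \<longlongrightarrow> exp (- (2 * \<sigma>\<^sup>2 * (1 - cos t)))) (at_left (\<sigma>\<^sup>2))"
      by (intro tendsto_intros)
    show "\<forall>\<^sub>F B in at_left (\<sigma>\<^sup>2). (norm (char \<nu> t))\<^sup>2 \<le> exp (- (2 * B * (1 - cos t)))"
      by (auto simp: eventually_at_left_field intro!: exI[of _ "\<sigma>\<^sup>2 - 1"] below)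
  qed simp
  also have "\<dots> = (exp (- (\<sigma>\<^sup>2 * (1 - cos t))))\<^sup>2"
  proof -
    have "- (2 * \<sigma>\<^sup>2 * (1 - cos t)) = 2 * (- (\<sigma>\<^sup>2 * (1 - cos t)))" by simp
    then show ?thesis by (simp only: exp_double)
  qed
  finally show ?thesis unfolding \<nu>_def by (rule power2_le_imp_le) simp
qed

section \<open>Masses of Y through residues modulo N\<close>

lemma exp_cos_lipschitz:
  fixes c :: real
  assumes "c \<ge> 0"
  shows "\<bar>exp (- (c * (1 - cos (2 * pi * x)))) - exp (- (c * (1 - cos (2 * pi * y))))\<bar>
    \<le> 2 * pi * c * \<bar>x - y\<bar>"
proof -
  let ?h = "\<lambda>x. exp (- (c * (1 - cos (2 * pi * x))))"
  let ?h' = "\<lambda>x. ?h x * (- (c * (2 * pi * sin (2 * pi * x))))"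
  have "norm (?h x - ?h y) \<le> (2 * pi * c) * norm (x - y)"
  proof (rule field_differentiable_bound[where f = ?h and f' = ?h' and S = UNIV])
    show "(?h has_field_derivative ?h' z) (at z within UNIV)" for z
      by (auto intro!: derivative_eq_intros)
    show "norm (?h' z) \<le> 2 * pi * c" for z
    proof -
      have "?h z \<le> 1" using assms by simp
      then have "?h z * (c * (2 * pi * \<bar>sin (2 * pi * z)\<bar>)) \<le> 1 * (c * (2 * pi * 1))"
        using assms by (intro mult_mono) auto
      then show ?thesis using assms by (simp add: abs_mult mult_ac)
    qed
  qed auto
  then show ?thesis by simp
qed

text \<open>At the frequencies 2 pi j / N the exponential of i t Y depends only on Y modulo N, so
  the characteristic function sampled there is the discrete Fourier transform of the law of the
  residue.\<close>

lemma (in prob_space) char_residues: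
  fixes Y :: "'a \<Rightarrow> int"
  assumes [measurable]: "Y \<in> measurable M (count_space UNIV)" and N: "N > 0"
  shows "char (distr M borel (\<lambda>\<omega>. real_of_int (Y \<omega>))) (2 * pi * real j / real N)
    = (\<Sum>r<N. prob {\<omega> \<in> space M. Y \<omega> mod int N = int r} * cis (2 * pi * real j * real r / real N))"
proof -
  define E where "E r = {\<omega> \<in> space M. Y \<omega> mod int N = int r}" for r
  have E: "E r \<in> events" for r unfolding E_def by measurable
  have "iexp (2 * pi * real j / real N * real_of_int (Y \<omega>))
    = (\<Sum>r<N. indicator (E r) \<omega> *\<^sub>R cis (2 * pi * real j * real r / real N))" if \<omega>: "\<omega> \<in> space M" for \<omega>
  proof -
    define s where "s = nat (Y \<omega> mod int N)"
    have s: "s < N" "int s = Y \<omega> mod int N" using N by (auto simp: s_def nat_less_iff)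
    define k where "k = Y \<omega> div int N"
    have Yk: "Y \<omega> = int s + int N * k" unfolding s(2) k_def by simp
    have "2 * pi * real j / real N * real_of_int (Y \<omega>)
        = 2 * pi * real j * real s / real N + 2 * pi * real_of_int (int j * k)"
      using N unfolding Yk by (simp add: field_simps)
    then have "iexp (2 * pi * real j / real N * real_of_int (Y \<omega>))
        = cis (2 * pi * real j * real s / real N) * cis (2 * pi * real_of_int (int j * k))"
      by (simp only: cis_conv_exp[symmetric] cis_mult)
    also have "cis (2 * pi * real_of_int (int j * k)) = 1" by (rule cis_multiple_2pi) auto
    also have "cis (2 * pi * real j * real s / real N) * 1
        = (\<Sum>r<N. if r = s then cis (2 * pi * real j * real r / real N) else 0)"
      using s by (simp add: sum.delta)
    also have "\<dots> = (\<Sum>r<N. indicator (E r) \<omega> *\<^sub>R cis (2 * pi * real j * real r / real N))"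
      using \<omega> s by (intro sum.cong) (auto simp: E_def indicator_def)
    finally show ?thesis .
  qed
  then have "char (distr M borel (\<lambda>\<omega>. real_of_int (Y \<omega>))) (2 * pi * real j / real N)
    = (CLINT \<omega>|M. (\<Sum>r<N. indicator (E r) \<omega> *\<^sub>R cis (2 * pi * real j * real r / real N)))"
    by (simp add: char_def integral_distr cong: Bochner_Integration.integral_cong)
  also have "\<dots> = (\<Sum>r<N. prob (E r) *\<^sub>R cis (2 * pi * real j * real r / real N))"
    using has_bochner_integral_indicator[OF E, unfolded has_bochner_integral_iff]
    by (subst Bochner_Integration.integral_sum) (auto simp: less_top[symmetric] simp del: integral_scaleR_left)
  finally show ?thesis by (simp add: E_def scaleR_conv_of_real)
qed

text \<open>The p-th power of the bound for the characteristic function merely multiplies v by p.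
  Its average over Z/N is a Riemann sum, with Lipschitz constant 2 pi p v, to which the comparison
  with the Gaussian applies.\<close>

lemma (in prob_space) sum_norm_char_le:
  assumes Y: "Y \<in> measurable M (count_space UNIV)"
    and char: "\<And>t. norm (char (distr M borel (\<lambda>\<omega>. real_of_int (Y \<omega>))) t) \<le> exp (- (v * (1 - cos t)))"
    and v: "v \<ge> 0" and p: "p \<ge> 0" and N: "N > 0"
  shows "(\<Sum>j<N. norm (\<Sum>r<N. prob {\<omega> \<in> space M. Y \<omega> mod int N = int r}
      * cis (2 * pi * real j * real r / real N)) powr p) / N
    \<le> integral {0..1} (\<lambda>x. exp (- (3 * (p * v) * x\<^sup>2))) + 2 * pi * (p * v) / N"
proof -
  let ?h = "\<lambda>x. exp (- ((p * v) * (1 - cos (2 * pi * x))))"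
  have pv: "p * v \<ge> 0" using p v by simp
  have "norm (\<Sum>r<N. prob {\<omega> \<in> space M. Y \<omega> mod int N = int r} * cis (2 * pi * real j * real r / real N)) powr p
      \<le> ?h (real j / real N)" for j
  proof -
    let ?t = "2 * pi * real j / real N"
    have "norm (\<Sum>r<N. prob {\<omega> \<in> space M. Y \<omega> mod int N = int r} * cis (2 * pi * real j * real r / real N)) powr p
        \<le> exp (- (v * (1 - cos ?t))) powr p"
      unfolding char_residues[OF Y N, symmetric] using char p by (intro powr_mono2) auto
    also have "\<dots> = ?h (real j / real N)" by (simp add: powr_def mult_ac)
    finally show ?thesis .
  qed
  then have "(\<Sum>j<N. norm (\<Sum>r<N. prob {\<omega> \<in> space M. Y \<omega> mod int N = int r}
      * cis (2 * pi * real j * real r / real N)) powr p) / N \<le> (\<Sum>j<N. ?h (real j / real N)) / N"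
    by (intro divide_right_mono sum_mono) auto
  also have "\<dots> \<le> integral {0..1} ?h + 2 * pi * (p * v) / N"
    by (rule riemann_sum_le_integral[OF exp_cos_lipschitz[OF pv] N])
  also have "integral {0..1} ?h = integral {0..1} (\<lambda>x. exp (- ((p * v) * (1 - cos (pi * x)))))"
    by (rule integral_cos_period[where k = "\<lambda>y. exp (- ((p * v) * (1 - y)))"]) (intro continuous_intros)
  also have "\<dots> \<le> integral {0..1} (\<lambda>x. exp (- (3 * (p * v) * x\<^sup>2)))"
    by (rule integral_exp_cos_le[OF pv])
  finally show ?thesis by simp
qed

lemma (in prob_space) mass_le_residue:
  assumes [measurable]: "Y \<in> measurable M (count_space UNIV)" and N: "N > 0"
  shows "mass M Y n \<le> prob {\<omega> \<in> space M. Y \<omega> mod int N = int (nat (n mod int N))}"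
  unfolding mass_def using N by (intro finite_measure_mono) (auto, measurable)

context prob_space
begin

context
  fixes Y :: "'a \<Rightarrow> int" and v :: real
  assumes Y: "Y \<in> measurable M (count_space UNIV)"
    and char: "\<And>t. norm (char (distr M borel (\<lambda>\<omega>. real_of_int (Y \<omega>))) t) \<le> exp (- (v * (1 - cos t)))"
    and v: "v \<ge> 0"
begin

text \<open>The endpoint \<alpha> = \<infinity>, \<alpha>' = 1: the dual inequality is tested
  against the point mass at the residue of n, and N tends to infinity.\<close>

lemma mass_le_gaussian: "mass M Y n \<le> integral {0..1} (\<lambda>x. exp (- (3 * v * x\<^sup>2)))"
proof (rule tendsto_lowerbound)
  let ?I = "integral {0..1} (\<lambda>x. exp (- (3 * v * x\<^sup>2)))"
  have "(\<lambda>N. ?I + 2 * pi * v * inverse (real (Suc N))) \<longlonglongrightarrow> ?I + 2 * pi * v * 0"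
    by (intro tendsto_intros LIMSEQ_inverse_real_of_nat)
  then show "(\<lambda>N. ?I + 2 * pi * v * inverse (real (Suc N))) \<longlonglongrightarrow> ?I" by simp
  show "\<forall>\<^sub>F N in sequentially. mass M Y n \<le> ?I + 2 * pi * v * inverse (real (Suc N))"
  proof (rule always_eventually, rule allI)
    fix N' :: nat
    define N where "N = Suc N'"
    have N: "N > 0" by (simp add: N_def)
    define r where "r = nat (n mod int N)"
    have r: "r < N" using N by (simp add: r_def nat_less_iff)
    define a where "a s = prob {\<omega> \<in> space M. Y \<omega> mod int N = int s}" for s
    have "mass M Y n \<le> a r" unfolding a_def r_def by (rule mass_le_residue[OF Y N])
    also have "\<dots> = (\<Sum>s<N. a s * (if s = r then 1 else 0))"
      using r by (simp add: if_distrib sum.delta cong: if_cong)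
    also have "\<dots> \<le> ((\<Sum>j<N. norm (\<Sum>r<N. a r * cis (2 * pi * real j * real r / real N)) powr 1) / N) powr (1/1)
        * (\<Sum>s<N. (if s = r then 1 else 0) powr 1) powr (1/1)"
      by (rule hausdorff_young_dual[OF N]) auto
    also have "(\<Sum>s<N. (if s = r then 1 else 0::real) powr 1) = (\<Sum>s<N. if s = r then 1 else 0)"
      by (intro sum.cong) auto
    also have "\<dots> = 1" using r by simp
    also have "((\<Sum>j<N. norm (\<Sum>r<N. a r * cis (2 * pi * real j * real r / real N)) powr 1) / N) powr (1/1) * 1 powr (1/1)
      = (\<Sum>j<N. norm (\<Sum>r<N. a r * cis (2 * pi * real j * real r / real N)) powr 1) / N"
      by (simp add: sum_nonneg)
    also have "\<dots> \<le> ?I + 2 * pi * v / N"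
      using sum_norm_char_le[OF Y char v, of 1 N] N by (simp add: a_def)
    finally show "mass M Y n \<le> ?I + 2 * pi * v * inverse (real (Suc N'))"
      by (simp add: N_def divide_inverse)
  qed
qed simp

text \<open>Restricting to a finite S lets the residues of its points be distinct for large N, so
  the sum is at most the full sum over Z/N. The bound does not depend on S, which makes the infinite
  sum accessible.\<close>

lemma sum_mass_powr_le_gaussian:
  assumes S: "finite S" and q: "2 \<le> q"
  shows "(\<Sum>n\<in>S. mass M Y n powr q)
    \<le> integral {0..1} (\<lambda>x. exp (- (3 * (q / (q - 1) * v) * x\<^sup>2))) powr (q - 1)"
proof (rule tendsto_lowerbound)
  define p where "p = q / (q - 1)"
  have p: "p \<ge> 0" using q by (simp add: p_def)
  let ?I = "integral {0..1} (\<lambda>x. exp (- (3 * (p * v) * x\<^sup>2)))"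
  have "(\<lambda>N. ?I + 2 * pi * (p * v) * inverse (real (Suc N))) \<longlonglongrightarrow> ?I + 2 * pi * (p * v) * 0"
    by (intro tendsto_intros LIMSEQ_inverse_real_of_nat)
  then show "(\<lambda>N. (?I + 2 * pi * (p * v) * inverse (real (Suc N))) powr (q - 1)) \<longlonglongrightarrow> ?I powr (q - 1)"
    using q p v by (intro tendsto_powr2) (auto intro!: always_eventually add_nonneg_nonneg integral_nonneg
      integrable_continuous_interval continuous_intros mult_nonneg_nonneg)
  obtain k where k: "\<And>n. n \<in> S \<Longrightarrow> \<bar>n\<bar> \<le> k"
    using S unfolding finite_int_iff_bounded_le by auto
  show "\<forall>\<^sub>F N in sequentially. (\<Sum>n\<in>S. mass M Y n powr q)
      \<le> (?I + 2 * pi * (p * v) * inverse (real (Suc N))) powr (q - 1)"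
  proof (rule eventually_sequentiallyI)
    \<comment> \<open>Points of S differ by at most 2 k, and N = N' + 1 exceeds 2 k, so reduction
      modulo N is injective on S.\<close>
    fix N' assume N': "N' \<ge> nat (2 * k)"
    define N where "N = Suc N'"
    have N: "N > 0" "2 * k < int N" using N' by (auto simp: N_def)
    define \<rho> where "\<rho> n = nat (n mod int N)" for n
    define a where "a s = prob {\<omega> \<in> space M. Y \<omega> mod int N = int s}" for s
    define P where "P = (\<Sum>j<N. norm (\<Sum>r<N. a r * cis (2 * pi * real j * real r / real N)) powr p) / N"
    have inj: "inj_on \<rho> S"
    proof (rule inj_onI)
      fix m n assume mn: "m \<in> S" "n \<in> S" "\<rho> m = \<rho> n"
      then have "m mod int N = n mod int N" using N by (simp add: \<rho>_def nat_eq_iff)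
      then have "int N dvd m - n" by (simp add: mod_eq_dvd_iff)
      moreover have "\<bar>m - n\<bar> < int N" using k[OF mn(1)] k[OF mn(2)] N by linarith
      ultimately show "m = n" using zdvd_imp_le[of "int N" "\<bar>m - n\<bar>"] by force
    qed
    have "(\<Sum>n\<in>S. mass M Y n powr q) \<le> (\<Sum>n\<in>S. a (\<rho> n) powr q)"
      using mass_le_residue[OF Y N(1)] q
      by (intro sum_mono powr_mono2) (auto simp: a_def \<rho>_def mass_def)
    also have "\<dots> = (\<Sum>r\<in>\<rho> ` S. a r powr q)" using inj by (simp add: sum.reindex)
    also have "\<dots> \<le> (\<Sum>r<N. a r powr q)"
      using N by (intro sum_mono2) (auto simp: \<rho>_def nat_less_iff)
    also have "\<dots> \<le> P powr (q - 1)"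
      unfolding P_def p_def by (rule hausdorff_young[OF N(1) q]) (simp add: a_def)
    also have "\<dots> \<le> (?I + 2 * pi * (p * v) * inverse (real (Suc N'))) powr (q - 1)"
    proof (intro powr_mono2)
      show "0 \<le> P" by (simp add: P_def sum_nonneg)
      show "P \<le> ?I + 2 * pi * (p * v) * inverse (real (Suc N'))"
        using sum_norm_char_le[OF Y char v p N(1)] unfolding P_def a_def N_def divide_inverse .
    qed (use q in simp)
    finally show "(\<Sum>n\<in>S. mass M Y n powr q)
      \<le> (?I + 2 * pi * (p * v) * inverse (real (Suc N'))) powr (q - 1)" .
  qed
qed simp

end

text \<open>Comparing logarithms requires the supremum or the power sum inside the entropy to be
  positive. Countably many null events cannot cover the space.\<close>

lemma mass_positive:
  assumes [measurable]: "Y \<in> measurable M (count_space UNIV)"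
  shows "\<exists>n. mass M Y n > 0"
proof (rule ccontr)
  assume "\<not> ?thesis"
  then have "prob {\<omega> \<in> space M. Y \<omega> = n} = 0" for n
    by (simp add: mass_def not_less measure_le_0_iff)
  then have "{\<omega> \<in> space M. Y \<omega> = n} \<in> null_sets M" for n
    by (intro null_setsI) (auto simp: emeasure_eq_measure)
  then have "(\<Union>n. {\<omega> \<in> space M. Y \<omega> = n}) \<in> null_sets M" by (intro null_sets_UN) auto
  moreover have "(\<Union>n. {\<omega> \<in> space M. Y \<omega> = n}) = space M" by auto
  ultimately show False using emeasure_space_1 by (simp add: null_sets_def)
qed

end

section \<open>The entropy bound\<close>

lemma gaussian_bounds:
  fixes c :: real
  assumes c: "c > 0"
  defines "L \<equiv> integral {0..1} (\<lambda>x. exp (- (3 * c * x\<^sup>2)))"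
  shows "L > 0"
    and "ln (sqrt (6 * c) / integral {0..sqrt (6 * c)} (\<lambda>t. exp (- t\<^sup>2 / 2))) = - ln L"
    and "1 / 2 * ln (1 + 2 * c) \<le> - ln L"
    and "1 / 2 * ln (12 * c / pi) \<le> - ln L"
proof -
  define s where "s = sqrt (6 * c)"
  have s: "s > 0" "s\<^sup>2 = 6 * c" using c by (auto simp: s_def)
  have G: "integral {0..s} (\<lambda>t. exp (- t\<^sup>2 / 2)) = s * L"
    using gaussian_integral_rescale[OF s(1)] by (simp add: s(2) L_def)
  \<comment> \<open>The minimum of the integrand, attained at x = 1, shows that L is
    positive.\<close>
  have "integral {0..1} (\<lambda>x::real. exp (- (3 * c))) \<le> L"
    unfolding L_def using c
    by (intro integral_le integrable_continuous_interval continuous_intros) (auto simp: power_le_one mult_left_le)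
  then have "exp (- (3 * c)) \<le> L" by simp
  then show L: "L > 0" using exp_gt_zero less_le_trans by blast
  have "s / (s * L) = inverse L" using s L by (simp add: field_simps)
  then show "ln (sqrt (6 * c) / integral {0..sqrt (6 * c)} (\<lambda>t. exp (- t\<^sup>2 / 2))) = - ln L"
    using L unfolding s_def[symmetric] G by (simp add: ln_inverse)
  have half: "1 / 2 * ln x \<le> - ln L" if "x > 0" "L \<le> 1 / sqrt x" for x
  proof -
    have "ln L \<le> ln (1 / sqrt x)" using that L by simp
    also have "\<dots> = - (1 / 2 * ln x)" using that by (simp add: ln_div ln_sqrt)
    finally show ?thesis by simp
  qed
  show "1 / 2 * ln (1 + 2 * c) \<le> - ln L"
  proof (rule half)
    have "s * L \<le> s * (1 / sqrt (1 + 2 * c))"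
      using gaussian_integral_le_algebraic[of s] s unfolding G by simp
    then show "L \<le> 1 / sqrt (1 + 2 * c)" using s by (simp only: mult_le_cancel_left_pos)
  qed (use c in simp)
  show "1 / 2 * ln (12 * c / pi) \<le> - ln L"
  proof (rule half)
    have "s * L \<le> sqrt (pi / 2)" using gaussian_integral_le_sqrt[OF s(1)] unfolding G .
    \<comment> \<open>Here 6 c / (12 c / pi) = pi / 2, which is where 12 / pi comes from.\<close>
    also have "\<dots> = s * (1 / sqrt (12 * c / pi))"
      using c by (simp add: s_def real_sqrt_divide[symmetric] real_sqrt_mult[symmetric])
    finally show "L \<le> 1 / sqrt (12 * c / pi)" using s by (simp only: mult_le_cancel_left_pos)
  qed (use c in simp)
qed

theorem theorem3p3:
  fixes M :: "'a measure" and Y :: "'a \<Rightarrow> int" and \<sigma> :: real and \<alpha> :: ereal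
  assumes "prob_space M"
    and "bernoulli_sum M Y"
    and "prob_space.variance M (\<lambda>\<omega>. real_of_int (Y \<omega>)) = \<sigma>\<^sup>2"
    and "\<sigma>\<^sup>2 > 0"
    and "2 \<le> \<alpha>"
  shows "renyi_entropy M \<alpha> Y \<ge>
           ln (sqrt (6 * \<sigma>\<^sup>2 * conj_exponent \<alpha>) /
               integral {0..sqrt (6 * \<sigma>\<^sup>2 * conj_exponent \<alpha>)} (\<lambda>t. exp (- t\<^sup>2 / 2)))
       \<and> renyi_entropy M \<alpha> Y \<ge>
           1 / 2 * max (ln (1 + 2 * conj_exponent \<alpha> * \<sigma>\<^sup>2))
                       (ln (12 * conj_exponent \<alpha> * \<sigma>\<^sup>2 / pi))"
proof -
  interpret prob_space M by fact
  define c where "c = conj_exponent \<alpha> * \<sigma>\<^sup>2"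
  define L where "L = integral {0..1} (\<lambda>x. exp (- (3 * c * x\<^sup>2)))"
  have Y: "Y \<in> measurable M (count_space UNIV)"
    using assms(2) by (simp add: bernoulli_sum_def)
  note char = bernoulli_sum_char_bound[OF assms(2-4)]
  have v: "0 \<le> \<sigma>\<^sup>2" by simp
  obtain n0 where n0: "mass M Y n0 > 0" using mass_positive[OF Y] by blast
  have "\<alpha> = \<infinity> \<or> (\<exists>q. \<alpha> = ereal q \<and> 2 \<le> q)"
    using assms(5) by (cases \<alpha>) auto
  then have *: "c > 0 \<and> - ln L \<le> renyi_entropy M \<alpha> Y"
  proof (elim disjE exE conjE)
    assume \<alpha>: "\<alpha> = \<infinity>"
    have c: "c = \<sigma>\<^sup>2" by (simp add: c_def \<alpha> conj_exponent_def)
    have le: "mass M Y n \<le> L" for n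
      unfolding L_def c by (rule mass_le_gaussian[OF Y char v])
    have "0 < mass M Y n0" by fact
    \<comment> \<open>The supremum of reals is meaningful only for a bounded family; the bound L
      serves for this as well as for the estimate.\<close>
    also have "\<dots> \<le> (SUP n. mass M Y n)" using le by (intro cSUP_upper bdd_aboveI2) auto
    finally have "0 < (SUP n. mass M Y n)" .
    moreover have "(SUP n. mass M Y n) \<le> L" using le by (intro cSUP_least) auto
    ultimately have "ln (SUP n. mass M Y n) \<le> ln L" by simp
    then show ?thesis using assms(4) by (simp add: c renyi_entropy_def \<alpha>)
  next
    fix q assume \<alpha>: "\<alpha> = ereal q" and q: "2 \<le> q"
    have c: "c = q / (q - 1) * \<sigma>\<^sup>2" by (simp add: c_def \<alpha> conj_exponent_def)
    have c0: "c > 0" unfolding c using q assms(4) by (intro mult_pos_pos) auto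
    have L0: "L > 0" unfolding L_def by (rule gaussian_bounds(1)[OF c0])
    have le: "(\<Sum>n\<in>S. mass M Y n powr q) \<le> L powr (q - 1)" if "finite S" for S
      unfolding L_def c by (rule sum_mass_powr_le_gaussian[OF Y char v that q])
    define T where "T = (\<Sum>\<^sub>\<infinity>n. mass M Y n powr q)"
    \<comment> \<open>An infinite sum of a non-summable family is 0 by convention; the uniform bound
      on finite sums rules this out.\<close>
    have summable: "(\<lambda>n. mass M Y n powr q) summable_on UNIV"
      using le by (intro nonneg_bdd_above_summable_on bdd_aboveI2) auto
    have "0 < (\<Sum>n\<in>{n0}. mass M Y n powr q)" using n0 by simp
    also have "\<dots> \<le> T"
      unfolding T_def by (rule finite_sum_le_infsum[OF summable]) auto
    finally have T0: "0 < T" .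
    have "T \<le> L powr (q - 1)" unfolding T_def using le by (intro infsum_le_finite_sums[OF summable])
    then have "ln T \<le> ln (L powr (q - 1))" using T0 L0 by (subst ln_le_cancel_iff) auto
    also have "\<dots> = (q - 1) * ln L" using L0 by (simp add: ln_powr)
    finally have "ln T / (q - 1) \<le> ln L" using q by (simp add: divide_le_eq mult.commute)
    \<comment> \<open>The prefactor 1 / (1 - q) is negative, so the upper bound on T becomes a lower
      bound on the entropy, and it cancels the exponent q - 1 of L.\<close>
    moreover have "renyi_entropy M \<alpha> Y = - (ln T / (q - 1))"
    proof -
      have "1 / (1 - q) = - (1 / (q - 1))" using q by (simp add: field_simps)
      then show ?thesis by (simp add: renyi_entropy_def \<alpha> T_def)
    qed
    ultimately show ?thesis using c0 by simp
  qed
  then have c: "c > 0" and H: "- ln L \<le> renyi_entropy M \<alpha> Y" by auto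
  have eqs: "6 * \<sigma>\<^sup>2 * conj_exponent \<alpha> = 6 * c" "1 + 2 * conj_exponent \<alpha> * \<sigma>\<^sup>2 = 1 + 2 * c"
    "12 * conj_exponent \<alpha> * \<sigma>\<^sup>2 / pi = 12 * c / pi"
    by (auto simp: c_def)
  show ?thesis
    unfolding eqs using H gaussian_bounds[OF c] by (auto simp: L_def max_def)
qed

end
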